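(* There exists a polynomial-time algorithm that, given as input a hypergraph $H=(V,\mathcal{E})$ and two acyclic orientations $h_1,h_2$ of $H$, outputs a flip sequence $\{u_1,v_1\},\dots,\{u_\ell,v_\ell\}$ from $h_1$ to $h_2$ such that $\ell\le\Delta_2(H)\cdot\mathrm{dist}(h_1,h_2)$, where $\mathrm{dist}(h_1,h_2)$ denotes the length of a shortest flip sequence from $h_1$ to $h_2$.
   Context: A hypergraph is $H=(V,\mathcal{E})$ with $\mathcal{E}\subseteq 2^V\setminus\{\emptyset\}$. An orientation is a map $h:\mathcal{E}\to V$ with $h(e)\in e$. Its digraph $D_h$ has vertex set $V$ and an arc $(u,v)$ iff some $e$ has $h(e)=v$ and $u\in e\setminus\{v\}$; $h$ is acyclic if $D_h$ is acyclic. For distinct acyclic orientations $h_1,h_2$ and distinct $u,v\in V$, $h_2$ is obtained from $h_1$ by a flip at $(u,v)$ if $h_2(e)=v$ for every $e\supseteq\{u,v\}$ with $h_1(e)=u$ and $h_2(e)=h_1(e)$ otherwise; flipping the unordered pair $\{u,v\}$ means flipping at $(u,v)$ or $(v,u)$. A flip sequence from $h_1$ to $h_2$ is a sequence of pairs $\{u_1,v_1\},\dots,\{u_\ell,v_\ell\}$ such that $h_2$ is obtained from $h_1$ by flipping them in order (all intermediate orientations being acyclic). The codegree of distinct $u,v$ is $|\{e\in\mathcal{E}:\{u,v\}\subseteq e\}|$, and $\Delta_2(H)$ is the maximum codegree over all pairs of distinct vertices. *)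

theory Defs
  imports
    "HOL-Library.FuncSet"
    "HOL-Library.Discrete_Functions"
    "HOL-Computational_Algebra.Polynomial"
begin

section \<open>Hypergraphs, acyclic orientations and flips\<close>

definition hypergraph :: "'a set \<Rightarrow> 'a set set \<Rightarrow> bool" where
  "hypergraph V E \<longleftrightarrow> finite V \<and> E \<subseteq> Pow V - {{}}"

text \<open>Orientations are extensional functions (\<open>undefined\<close> outside \<open>E\<close>), so that equality of
  HOL functions is equality of maps on \<open>E\<close>.\<close>

definition orientation :: "'a set set \<Rightarrow> ('a set \<Rightarrow> 'a) \<Rightarrow> bool" where
  "orientation E h \<longleftrightarrow> h \<in> (\<Pi>\<^sub>E e\<in>E. e)"

definition arcs :: "'a set set \<Rightarrow> ('a set \<Rightarrow> 'a) \<Rightarrow> ('a \<times> 'a) set" where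
  "arcs E h = {(u, v). \<exists>e\<in>E. h e = v \<and> u \<in> e - {v}}"

definition acyclic_orientation :: "'a set set \<Rightarrow> ('a set \<Rightarrow> 'a) \<Rightarrow> bool" where
  "acyclic_orientation E h \<longleftrightarrow> orientation E h \<and> acyclic (arcs E h)"

definition flip_at ::
  "'a set \<Rightarrow> 'a set set \<Rightarrow> 'a \<Rightarrow> 'a \<Rightarrow> ('a set \<Rightarrow> 'a) \<Rightarrow> ('a set \<Rightarrow> 'a) \<Rightarrow> bool" where
  "flip_at V E u v h h' \<longleftrightarrow>
     acyclic_orientation E h \<and> acyclic_orientation E h' \<and> h \<noteq> h' \<and>
     u \<in> V \<and> v \<in> V \<and> u \<noteq> v \<and>
     (\<forall>e\<in>E. h' e = (if {u, v} \<subseteq> e \<and> h e = u then v else h e))"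

definition flip_pair ::
  "'a set \<Rightarrow> 'a set set \<Rightarrow> 'a set \<Rightarrow> ('a set \<Rightarrow> 'a) \<Rightarrow> ('a set \<Rightarrow> 'a) \<Rightarrow> bool" where
  "flip_pair V E P h h' \<longleftrightarrow>
     (\<exists>u v. P = {u, v} \<and> (flip_at V E u v h h' \<or> flip_at V E v u h h'))"

fun flip_sequence ::
  "'a set \<Rightarrow> 'a set set \<Rightarrow> ('a set \<Rightarrow> 'a) \<Rightarrow> 'a set list \<Rightarrow> ('a set \<Rightarrow> 'a) \<Rightarrow> bool" where
  "flip_sequence V E h [] h' \<longleftrightarrow> h = h'"
| "flip_sequence V E h (P # Ps) h' \<longleftrightarrow>
     (\<exists>k. flip_pair V E P h k \<and> flip_sequence V E k Ps h')"

text \<open>As a \<open>LEAST\<close>, this is unspecified when \<open>h\<close> and \<open>h'\<close> are not connected by flips.\<close>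

definition flip_dist ::
  "'a set \<Rightarrow> 'a set set \<Rightarrow> ('a set \<Rightarrow> 'a) \<Rightarrow> ('a set \<Rightarrow> 'a) \<Rightarrow> nat" where
  "flip_dist V E h h' = (LEAST l. \<exists>Ps. flip_sequence V E h Ps h' \<and> length Ps = l)"

definition codegree :: "'a set set \<Rightarrow> 'a \<Rightarrow> 'a \<Rightarrow> nat" where
  "codegree E u v = card {e \<in> E. {u, v} \<subseteq> e}"

text \<open>The inserted \<open>0\<close> only matters when there are fewer than two vertices; the maximum over no
  pairs is taken to be \<open>0\<close>.\<close>

definition max_codegree :: "'a set \<Rightarrow> 'a set set \<Rightarrow> nat" where
  "max_codegree V E = Max (insert 0 {codegree E u v |u v. u \<in> V \<and> v \<in> V \<and> u \<noteq> v})"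


section \<open>Algorithms: random access machines with logarithmic cost\<close>

text \<open>
  The machine has a memory of registers holding arbitrary natural numbers (all initially \<open>0\<close>), a
  read-only input tape and a write-only output tape, as in Aho, Hopcroft and Ullman, but with
  structured control flow instead of jumps. Its arithmetic consists of addition and truncated
  subtraction. Every number that is produced or accessed, register addresses included, is charged
  its bit length, so that polynomial time means the same as for Turing machines.
\<close>

definition bit_length :: "nat \<Rightarrow> nat" where
  "bit_length n = floor_log n + 1"

type_synonym memory = "nat \<Rightarrow> nat"

datatype expr = Const nat | Load expr | Add expr expr | Sub expr expr

fun expr_val :: "expr \<Rightarrow> memory \<Rightarrow> nat" where
  "expr_val (Const n) m = n"
| "expr_val (Load a) m = m (expr_val a m)"
| "expr_val (Add a b) m = expr_val a m + expr_val b m"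
| "expr_val (Sub a b) m = expr_val a m - expr_val b m"

fun expr_cost :: "expr \<Rightarrow> memory \<Rightarrow> nat" where
  "expr_cost (Const n) m = bit_length n"
| "expr_cost (Load a) m = expr_cost a m + bit_length (expr_val (Load a) m)"
| "expr_cost (Add a b) m = expr_cost a m + expr_cost b m + bit_length (expr_val (Add a b) m)"
| "expr_cost (Sub a b) m = expr_cost a m + expr_cost b m + bit_length (expr_val (Sub a b) m)"

text \<open>\<open>Store a b\<close> writes the value of \<open>b\<close> to the register whose address is the value of \<open>a\<close>;
  \<open>Read a\<close> does the same with the next input symbol. Conditions hold iff they are nonzero.\<close>

datatype prog =
    Skip
  | Store expr expr
  | Read expr
  | Write expr
  | Seq prog prog
  | Cond expr prog prog
  | While expr prog

type_synonym config = "memory \<times> nat list \<times> nat list"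

text \<open>\<open>exec c s t s'\<close>: started in \<open>s\<close> (memory, remaining input, output so far), \<open>c\<close> terminates in
  \<open>s'\<close> after time \<open>t\<close>. Reading past the end of the input is an error: there is no execution.\<close>

inductive exec :: "prog \<Rightarrow> config \<Rightarrow> nat \<Rightarrow> config \<Rightarrow> bool" where
  Skip: "exec Skip s 1 s"
| Store: "exec (Store a b) (m, inp, out) (expr_cost a m + expr_cost b m)
            (m(expr_val a m := expr_val b m), inp, out)"
| Read: "exec (Read a) (m, x # inp, out) (expr_cost a m + bit_length x)
            (m(expr_val a m := x), inp, out)"
| Write: "exec (Write a) (m, inp, out) (expr_cost a m) (m, inp, out @ [expr_val a m])"
| Seq: "exec c s t s' \<Longrightarrow> exec d s' t' s'' \<Longrightarrow> exec (Seq c d) s (t + t') s''"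
| CondTrue: "expr_val b (fst s) \<noteq> 0 \<Longrightarrow> exec c s t s' \<Longrightarrow>
    exec (Cond b c d) s (expr_cost b (fst s) + t) s'"
| CondFalse: "expr_val b (fst s) = 0 \<Longrightarrow> exec d s t s' \<Longrightarrow>
    exec (Cond b c d) s (expr_cost b (fst s) + t) s'"
| WhileFalse: "expr_val b (fst s) = 0 \<Longrightarrow> exec (While b c) s (expr_cost b (fst s)) s"
| WhileTrue: "expr_val b (fst s) \<noteq> 0 \<Longrightarrow> exec c s t s' \<Longrightarrow> exec (While b c) s' t' s'' \<Longrightarrow>
    exec (While b c) s (expr_cost b (fst s) + t + t') s''"

lemma exec_deterministic:
  "exec c s t s' \<Longrightarrow> exec c s u s'' \<Longrightarrow> t = u \<and> s' = s''"
proof (induction arbitrary: u s'' rule: exec.induct)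
  case (Seq c s t s' d t' s'')
  note IH = Seq.IH
  from Seq.prems show ?case
  proof cases
    case (Seq u1 r u2)
    have 1: "t = u1" "s' = r"
      using IH(1)[OF \<open>exec c s u1 r\<close>] by blast+
    show ?thesis
      using IH(2)[OF \<open>exec d r u2 _\<close>[folded 1(2)]] 1(1) Seq(1) by blast
  qed
next
  case (WhileTrue b s c t s' t' s'')
  note hyp = WhileTrue.hyps(1) and IH = WhileTrue.IH
  from WhileTrue.prems show ?case
  proof cases
    case WhileFalse
    with hyp show ?thesis by blast
  next
    case (WhileTrue u1 r u2)
    have 1: "t = u1" "s' = r"
      using IH(1)[OF \<open>exec c s u1 r\<close>] by blast+
    show ?thesis
      using IH(2)[OF \<open>exec (While b c) r u2 _\<close>[folded 1(2)]] 1(1) WhileTrue(1) by blast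
  qed
next
  case (CondTrue b s c t s' d)
  note hyp = CondTrue.hyps(1) and IH = CondTrue.IH
  from CondTrue.prems show ?case
    by cases (use hyp in \<open>blast dest: IH\<close>)+
next
  case (CondFalse b s d t s' c)
  note hyp = CondFalse.hyps(1) and IH = CondFalse.IH
  from CondFalse.prems show ?case
    by cases (use hyp in \<open>blast dest: IH\<close>)+
next
  case (WhileFalse b s c)
  note hyp = WhileFalse.hyps(1)
  from WhileFalse.prems show ?case
    by cases (use hyp in blast)+
qed (erule exec.cases; simp)+

definition runs :: "prog \<Rightarrow> nat list \<Rightarrow> nat \<Rightarrow> nat list \<Rightarrow> bool" where
  "runs c inp t out \<longleftrightarrow> (\<exists>m rest. exec c (\<lambda>_. 0, inp, []) t (m, rest, out))"

definition tape_size :: "nat list \<Rightarrow> nat" where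
  "tape_size w = (\<Sum>x\<leftarrow>w. bit_length x)"


section \<open>Inputs and outputs as tapes\<close>

text \<open>Vertices are named by arbitrary natural numbers. A hypergraph is given by listing its vertices
  and its edges without repetitions, in any order; each edge is listed with its number of elements,
  its elements, and its heads under the two orientations.\<close>

definition encode_edge ::
  "(nat set \<Rightarrow> nat) \<Rightarrow> (nat set \<Rightarrow> nat) \<Rightarrow> nat list \<Rightarrow> nat list" where
  "encode_edge h1 h2 xs = length xs # xs @ [h1 (set xs), h2 (set xs)]"

definition encodes_instance ::
  "nat list \<Rightarrow> nat set \<Rightarrow> nat set set \<Rightarrow> (nat set \<Rightarrow> nat) \<Rightarrow> (nat set \<Rightarrow> nat) \<Rightarrow> bool" where
  "encodes_instance w V E h1 h2 \<longleftrightarrow>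
     (\<exists>vs es. distinct vs \<and> set vs = V \<and>
        (\<forall>xs\<in>set es. distinct xs) \<and> distinct (map set es) \<and> set (map set es) = E \<and>
        w = length vs # vs @ length es # concat (map (encode_edge h1 h2) es))"

definition encode_pairs :: "(nat \<times> nat) list \<Rightarrow> nat list" where
  "encode_pairs ps = concat (map (\<lambda>(u, v). [u, v]) ps)"

end

theory Submission imports Defs begin

text \<open>
  A flip at \<open>{u, v}\<close> changes the heads of at most \<open>\<Delta>\<close> edges, where \<open>\<Delta>\<close> is the maximum
  codegree, so the number of edges with different heads under \<open>h1\<close> and \<open>h2\<close> is at most
  \<open>\<Delta>\<close> times the flip distance. It therefore suffices to reach \<open>h2\<close> by flips each of which
  moves the head of some edge directly from its place under \<open>h1\<close> to its place under \<open>h2\<close>, with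
  every edge changed at most once.

  Selection sort does this. Extend \<open>h1\<close> and \<open>h2\<close> to linear orders of the vertices, in which the
  head of an edge is its greatest element. In the first order, move the greatest vertex \<open>v\<close> of the
  second order to the top by adjacent transpositions, then the second greatest below it, and so on.
  Passing \<open>v\<close> over \<open>u\<close> is a flip if some edge currently has head \<open>u\<close> and contains \<open>v\<close>, and does
  nothing otherwise; the edges concerned are those with \<open>h1 e = u\<close> and \<open>h2 e = v\<close>. Hence the
  flips are just the pairs \<open>(h1 e, h2 e)\<close> of distinct heads, sorted by decreasing \<open>h2 e\<close> and
  then by increasing \<open>h1 e\<close>. Rank functions that increase along the arcs can take the place of the
  linear orders if ties of \<open>h2 e\<close> are broken by the names of the vertices.
\<close>


section \<open>Sorted flips\<close>

lemma flip_pair_card_diff: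
  assumes "hypergraph V E" "flip_pair V E P h k"
  shows "card {e \<in> E. h e \<noteq> k e} \<le> max_codegree V E"
proof -
  have fin: "finite V" "finite E"
    using assms(1) finite_subset[of E "Pow V"] by (auto simp: hypergraph_def)
  obtain u v where "flip_at V E u v h k"
    using assms(2) by (auto simp: flip_pair_def)
  then have uv: "u \<in> V" "v \<in> V" "u \<noteq> v"
    and flip: "\<And>e. e \<in> E \<Longrightarrow> k e = (if {u, v} \<subseteq> e \<and> h e = u then v else h e)"
    by (auto simp: flip_at_def)
  \<comment> \<open>An edge whose head changes contains both vertices of the pair, so a single
    codegree counts all of them.\<close>
  have sub: "{e \<in> E. h e \<noteq> k e} \<subseteq> {e \<in> E. {u, v} \<subseteq> e}"
  proof
    fix e assume "e \<in> {e \<in> E. h e \<noteq> k e}"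
    then have "e \<in> E" "h e \<noteq> k e" by simp_all
    then have "{u, v} \<subseteq> e" using flip[of e] by argo
    with \<open>e \<in> E\<close> show "e \<in> {e \<in> E. {u, v} \<subseteq> e}" by blast
  qed
  have "card {e \<in> E. h e \<noteq> k e} \<le> codegree E u v"
    unfolding codegree_def using fin sub by (intro card_mono) auto
  also have "\<dots> \<le> max_codegree V E"
  proof -
    have "{codegree E u v |u v. u \<in> V \<and> v \<in> V \<and> u \<noteq> v} \<subseteq> (\<lambda>(u, v). codegree E u v) ` (V \<times> V)"
      by auto
    then have "finite {codegree E u v |u v. u \<in> V \<and> v \<in> V \<and> u \<noteq> v}"
      by (rule finite_subset) (use fin in auto)
    then show ?thesis
      unfolding max_codegree_def using uv by (intro Max_ge) auto
  qed
  finally show ?thesis .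
qed

text \<open>Disagreement sets obey a triangle inequality: where \<open>h\<close> and
  \<open>h'\<close> differ, \<open>h\<close> and \<open>k\<close> or \<open>k\<close> and
  \<open>h'\<close> differ. Each flip thus contributes at most one maximum codegree.\<close>

lemma flip_sequence_card_diff:
  assumes "hypergraph V E" "flip_sequence V E h Ps h'"
  shows "card {e \<in> E. h e \<noteq> h' e} \<le> max_codegree V E * length Ps"
  using assms(2)
proof (induction Ps arbitrary: h)
  case (Cons P Ps)
  then obtain k where k: "flip_pair V E P h k" "flip_sequence V E k Ps h'" by auto
  have "finite E"
    using assms(1) finite_subset[of E "Pow V"] by (auto simp: hypergraph_def)
  then have "card {e \<in> E. h e \<noteq> h' e} \<le> card ({e \<in> E. h e \<noteq> k e} \<union> {e \<in> E. k e \<noteq> h' e})"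
    by (intro card_mono) auto
  also have "\<dots> \<le> card {e \<in> E. h e \<noteq> k e} + card {e \<in> E. k e \<noteq> h' e}"
    by (rule card_Un_le)
  also have "\<dots> \<le> max_codegree V E + max_codegree V E * length Ps"
    using flip_pair_card_diff[OF assms(1) k(1)] Cons.IH[OF k(2)] by (rule add_mono)
  finally show ?case by simp
qed simp

text \<open>\<open>Ps\<close> ensures that the \<open>LEAST\<close> in \<open>flip_dist\<close> is
  attained; the count is then applied to a shortest sequence.\<close>

lemma card_diff_le_flip_dist:
  assumes "hypergraph V E" "flip_sequence V E h Ps h'"
  shows "card {e \<in> E. h e \<noteq> h' e} \<le> max_codegree V E * flip_dist V E h h'"
proof -
  have "\<exists>Qs. flip_sequence V E h Qs h' \<and> length Qs = flip_dist V E h h'"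
    unfolding flip_dist_def by (rule LeastI_ex) (use assms(2) in blast)
  then show ?thesis using flip_sequence_card_diff[OF assms(1)] by metis
qed

text \<open>Strict increase along the arcs of \<open>arcs E h\<close>: a topological numbering in
  which vertices may share a value.\<close>

definition ranks :: "'a set set \<Rightarrow> ('a set \<Rightarrow> 'a) \<Rightarrow> ('a \<Rightarrow> nat) \<Rightarrow> bool" where
  "ranks E h f \<longleftrightarrow> (\<forall>e\<in>E. \<forall>x\<in>e. x \<noteq> h e \<longrightarrow> f x < f (h e))"

text \<open>A set, because one flip serves all edges with the same two heads.\<close>

definition head_pairs :: "'a set set \<Rightarrow> ('a set \<Rightarrow> 'a) \<Rightarrow> ('a set \<Rightarrow> 'a) \<Rightarrow> ('a \<times> 'a) set" where
  "head_pairs E h1 h2 = {(h1 e, h2 e) |e. e \<in> E \<and> h1 e \<noteq> h2 e}"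

text \<open>Comparing names when \<open>g\<close> has a tie keeps pairs with a common second
  component together. Ties of \<open>f\<close> may be resolved either way.\<close>

definition flip_before :: "('a \<Rightarrow> nat) \<Rightarrow> ('a \<Rightarrow> nat) \<Rightarrow> 'a::linorder \<times> 'a \<Rightarrow> 'a \<times> 'a \<Rightarrow> bool" where
  "flip_before f g p q \<longleftrightarrow>
     g (snd q) < g (snd p) \<or>
     g (snd p) = g (snd q) \<and> (snd p < snd q \<or> snd p = snd q \<and> f (fst p) \<le> f (fst q))"

text \<open>The orientation reached once the pairs in \<open>D\<close> have been flipped. It is
  \<open>undefined\<close> outside \<open>E\<close>, so that it can equal \<open>h1\<close> or
  \<open>h2\<close> as a function.\<close>

definition partial_switch ::
  "'a set set \<Rightarrow> ('a set \<Rightarrow> 'a) \<Rightarrow> ('a set \<Rightarrow> 'a) \<Rightarrow> ('a \<times> 'a) set \<Rightarrow> 'a set \<Rightarrow> 'a" where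
  "partial_switch E h1 h2 D = (\<lambda>e\<in>E. if (h1 e, h2 e) \<in> D then h2 e else h1 e)"

section \<open>Validity and length of the sorted flip sequence\<close>

locale sorted_flips =
  fixes V :: "'a::linorder set" and E h1 h2 f g ps
  assumes hyp: "hypergraph V E"
    and ao1: "acyclic_orientation E h1" and ao2: "acyclic_orientation E h2"
    and ranks1: "ranks E h1 f" and ranks2: "ranks E h2 g"
    and dist: "distinct ps" and set_ps: "set ps = head_pairs E h1 h2"
    and sorted: "sorted_wrt (flip_before f g) ps"
begin

lemma heads_in: "e \<in> E \<Longrightarrow> h1 e \<in> e" "e \<in> E \<Longrightarrow> h2 e \<in> e"
  using ao1 ao2 by (auto simp: acyclic_orientation_def orientation_def)

lemma rank1: "e \<in> E \<Longrightarrow> x \<in> e \<Longrightarrow> x \<noteq> h1 e \<Longrightarrow> f x < f (h1 e)"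
  using ranks1 by (auto simp: ranks_def)

lemma rank2: "e \<in> E \<Longrightarrow> x \<in> e \<Longrightarrow> x \<noteq> h2 e \<Longrightarrow> g x < g (h2 e)"
  using ranks2 by (auto simp: ranks_def)

text \<open>Both components lie in a common edge, of which \<open>a\<close> is the greatest vertex
  for \<open>f\<close> and \<open>b\<close> the greatest for \<open>g\<close>.\<close>

lemma pair_ranks:
  assumes "(a, b) \<in> set ps"
  shows "a \<noteq> b" "f b < f a" "g a < g b" "a \<in> V" "b \<in> V"
proof -
  obtain e where e: "e \<in> E" "h1 e = a" "h2 e = b" "a \<noteq> b"
    using assms set_ps by (auto simp: head_pairs_def)
  then show "a \<noteq> b" "f b < f a" "g a < g b" "a \<in> V" "b \<in> V"
    using rank1[of e b] rank2[of e a] heads_in[of e] hyp by (auto simp: hypergraph_def)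
qed

lemma orientation_partial_switch: "orientation E (partial_switch E h1 h2 D)"
  using heads_in by (auto simp: orientation_def partial_switch_def)

text \<open>Before the first flip the arcs are those of \<open>h1\<close>. Afterwards the last pair
  flipped tells how far the sort has come, and a potential built from it increases along every
  arc.\<close>

lemma acyclic_partial_switch:
  assumes ps: "ps = qs @ rs"
  shows "acyclic (arcs E (partial_switch E h1 h2 (set qs)))" (is "acyclic (arcs E ?h)")
proof (cases qs rule: rev_cases)
  case Nil
  have "arcs E ?h = arcs E h1"
    using Nil by (auto simp: arcs_def partial_switch_def)
  then show ?thesis using ao1 by (simp add: acyclic_orientation_def)
next
  case (snoc qs' p)
  obtain a0 b0 where p: "p = (a0, b0)" by (cases p)
  have before: "q = (a0, b0) \<or> flip_before f g q (a0, b0)" if "q \<in> set qs" for q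
    using that sorted by (auto simp: ps snoc p sorted_wrt_append)
  have after: "flip_before f g (a0, b0) q" if "q \<in> set rs" for q
    using that sorted by (auto simp: ps snoc p sorted_wrt_append)
  have disj: "q \<notin> set rs" if "q \<in> set qs" for q
    using that dist by (auto simp: ps)
  have p_in: "(a0, b0) \<in> set ps" "(a0, b0) \<in> set qs" by (auto simp: ps snoc p)
  note r0 = pair_ranks[OF p_in(1)]
  text \<open>After the last flip \<open>(a0, b0)\<close>, every edge has a unique vertex of greatest potential, its
    head: the vertices of \<open>U\<close>, already moved to the top, come last and in the order of \<open>g\<close>. The
    others are ordered by \<open>f\<close>, except that \<open>b0\<close> has been moved up, on level \<open>f a0\<close>, above the
    vertices it was already flipped with and below those it has yet to be flipped with.\<close>
  define U where "U = {v. g b0 < g v \<or> g v = g b0 \<and> v < b0}"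
  \<comment> \<open>Within one level of \<open>f\<close> the offsets 0, 1, 2 belong to ordinary
    vertices, \<open>b0\<close>, and vertices awaiting their flip with \<open>b0\<close>; the factor
    4 keeps different levels apart.\<close>
  define \<phi> where "\<phi> v = (if v \<in> U then (1, g v) else if v = b0 then (0, 4 * f a0 + 1)
      else (0::nat, 4 * f v + (if (v, b0) \<in> set rs then 2 else 0)))" for v
  have "(\<phi> x, \<phi> (?h e)) \<in> less_than <*lex*> less_than"
    if e: "e \<in> E" and x: "x \<in> e" "x \<noteq> ?h e" for e x
  proof -
    have head: "?h e = (if (h1 e, h2 e) \<in> set qs then h2 e else h1 e)"
      using e by (simp add: partial_switch_def)
    have in_ps: "(h1 e, h2 e) \<in> set qs \<or> (h1 e, h2 e) \<in> set rs" if "h1 e \<noteq> h2 e"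
      using that e set_ps by (auto simp: ps head_pairs_def)
    have b0U: "b0 \<notin> U" by (simp add: U_def)
    consider "h2 e \<in> U" | "h2 e = b0" | "h2 e \<notin> U" "h2 e \<noteq> b0" by blast
    then show ?thesis
    proof cases
      \<comment> \<open>The target of \<open>e\<close> was moved to the top before
        \<open>b0\<close>, so the flip of \<open>e\<close>, if one is needed, is already
        done.\<close>
      case 1
      have "(h1 e, h2 e) \<notin> set rs"
        using 1 after[of "(h1 e, h2 e)"] by (auto simp: U_def flip_before_def)
      then have "?h e = h2 e" using in_ps head by auto
      then show ?thesis using 1 x rank2[OF e x(1)] by (auto simp: \<phi>_def)
    next
      \<comment> \<open>The target of \<open>e\<close> is the vertex being moved: \<open>e\<close>
        may be flipped, in no need of a flip, or still waiting.\<close>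
      case 2
      have U: "y \<notin> U" if "y \<in> e" for y
        using rank2[OF e that] 2 by (cases "y = h2 e") (auto simp: U_def)
      have *: "f x \<le> f (h1 e)" "f x = f (h1 e) \<Longrightarrow> x = h1 e"
        using rank1[OF e x(1)] by (cases "x = h1 e"; simp)+
      consider "(h1 e, b0) \<in> set qs" | "h1 e = b0" | "(h1 e, b0) \<in> set rs" "h1 e \<noteq> b0"
        using in_ps 2 by auto
      then show ?thesis
      proof cases
        \<comment> \<open>The critical \<open>x\<close> is \<open>h1 e\<close>, possibly on the
          level \<open>f a0\<close> of \<open>b0\<close>. Its flip is done, so it has offset 0 and
          stays below \<open>b0\<close>.\<close>
        case q: 1
        then have h: "?h e = b0" using head 2 by simp
        have "f (h1 e) \<le> f a0" using before[OF q] by (auto simp: flip_before_def)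
        moreover have "(h1 e, b0) \<notin> set rs" using disj[OF q] .
        ultimately show ?thesis
          using h x U[OF x(1)] * b0U by (cases "f x = f (h1 e)") (auto simp: \<phi>_def)
      next
        \<comment> \<open>All other vertices of \<open>e\<close> were below \<open>b0\<close> for
          \<open>f\<close>, and \<open>f b0 < f a0\<close>, so raising \<open>b0\<close> to level
          \<open>f a0\<close> does no harm.\<close>
        case q: 2
        then have h: "?h e = b0" using head 2 by simp
        then show ?thesis using q x U[OF x(1)] rank1[OF e x(1)] r0 b0U by (auto simp: \<phi>_def)
      next
        \<comment> \<open>Now \<open>x\<close> may be \<open>b0\<close>: the head lies on level
          \<open>f a0\<close> or higher and has offset 2 against the 1 of \<open>b0\<close>.\<close>
        case q: 3
        then have h: "?h e = h1 e" using head 2 disj by auto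
        have "f a0 \<le> f (h1 e)" using after[OF q(1)] by (auto simp: flip_before_def)
        then show ?thesis
          using h q x U[OF x(1)] U[OF heads_in(1)[OF e]] rank1[OF e x(1)] b0U by (auto simp: \<phi>_def)
      qed
    next
      \<comment> \<open>The target of \<open>e\<close> has yet to be moved. It is greatest in
        \<open>e\<close> for \<open>g\<close>, so \<open>e\<close> avoids both \<open>U\<close> and
        \<open>b0\<close>, and \<open>f\<close> alone decides.\<close>
      case 3
      have c: "g (h2 e) < g b0 \<or> g (h2 e) = g b0 \<and> b0 < h2 e"
        using 3 by (auto simp: U_def)
      have U: "y \<notin> U \<and> y \<noteq> b0" if "y \<in> e" for y
        using rank2[OF e that] 3 c by (cases "y = h2 e") (auto simp: U_def)
      have "(h1 e, h2 e) \<notin> set qs"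
        using before[of "(h1 e, h2 e)"] c by (auto simp: flip_before_def)
      then have h: "?h e = h1 e" using head by simp
      show ?thesis
        using h x U[OF x(1)] U[OF heads_in(1)[OF e]] rank1[OF e x(1)] by (auto simp: \<phi>_def)
    qed
  qed
  then have "arcs E ?h \<subseteq> inv_image (less_than <*lex*> less_than) \<phi>"
    by (auto simp: arcs_def)
  moreover have "wf (inv_image (less_than <*lex*> less_than) \<phi>)"
    by (intro wf_inv_image wf_lex_prod wf_less_than)
  ultimately show ?thesis using wf_acyclic wf_subset by blast
qed

text \<open>The flip must not move any edge with another pair of heads. If such an edge contained
  \<open>b\<close> and had current head \<open>a\<close>, its final head would exceed
  \<open>b\<close> for \<open>g\<close>, so its own flip would have come earlier and taken the head
  away from \<open>a\<close>.\<close>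

lemma flip_at_partial_switch:
  assumes ps: "ps = qs @ (a, b) # rs"
  shows "flip_at V E a b (partial_switch E h1 h2 (set qs)) (partial_switch E h1 h2 (set (qs @ [(a, b)])))"
    (is "flip_at V E a b ?h ?k")
proof -
  have p_in: "(a, b) \<in> set ps" by (simp add: ps)
  note r = pair_ranks[OF p_in]
  have new: "(a, b) \<notin> set qs" using dist by (simp add: ps)
  have eq: "?k e = (if {a, b} \<subseteq> e \<and> ?h e = a then b else ?h e)" if e: "e \<in> E" for e
  proof (cases "(h1 e, h2 e) = (a, b)")
    case True
    then show ?thesis using e new heads_in[OF e] by (auto simp: partial_switch_def)
  next
    case False
    have "\<not> ({a, b} \<subseteq> e \<and> ?h e = a)"
    proof
      assume *: "{a, b} \<subseteq> e \<and> ?h e = a"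
      have "h2 e \<noteq> a" using rank2[OF e, of b] * r by auto
      then have "h1 e = a" "(a, h2 e) \<notin> set qs" using * e by (auto simp: partial_switch_def split: if_splits)
      moreover have "h2 e \<noteq> b" using False calculation by auto
      then have "g b < g (h2 e)" using rank2[OF e, of b] * by auto
      moreover have "(a, h2 e) \<in> set ps"
        using set_ps e \<open>h1 e = a\<close> \<open>h2 e \<noteq> a\<close> by (auto simp: head_pairs_def)
      then have "(a, h2 e) \<in> set rs" using calculation \<open>h2 e \<noteq> b\<close> by (auto simp: ps)
      then have "flip_before f g (a, b) (a, h2 e)"
        using sorted by (auto simp: ps sorted_wrt_append)
      ultimately show False by (auto simp: flip_before_def)
    qed
    then show ?thesis using e False by (auto simp: partial_switch_def)
  qed
  \<comment> \<open>A flip has to change something: the edge that gave rise to the pair does change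
    its head.\<close>
  obtain e where e: "e \<in> E" "h1 e = a" "h2 e = b"
    using p_in set_ps by (auto simp: head_pairs_def)
  have "?h e \<noteq> ?k e" using e new r by (simp add: partial_switch_def)
  then have "?h \<noteq> ?k" by metis
  then show ?thesis
    using eq r orientation_partial_switch acyclic_partial_switch[of qs "(a, b) # rs"]
      acyclic_partial_switch[of "qs @ [(a, b)]" rs]
    by (auto simp: flip_at_def acyclic_orientation_def ps)
qed

lemma flip_sequence_partial_switch:
  assumes "ps = qs @ rs"
  shows "flip_sequence V E (partial_switch E h1 h2 (set qs)) (map (\<lambda>(u, v). {u, v}) rs) h2"
  using assms
proof (induction rs arbitrary: qs)
  case Nil
  have "partial_switch E h1 h2 (set qs) e = h2 e" for e
    using Nil set_ps ao2 by (cases "e \<in> E")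
      (auto simp: partial_switch_def acyclic_orientation_def orientation_def head_pairs_def
        PiE_def extensional_def)
  then show ?case by auto
next
  case (Cons p rs)
  obtain a b where p: "p = (a, b)" by (cases p)
  have "flip_pair V E {a, b} (partial_switch E h1 h2 (set qs)) (partial_switch E h1 h2 (set (qs @ [p])))"
    using flip_at_partial_switch[of qs a b rs] Cons.prems p unfolding flip_pair_def by blast
  moreover have "flip_sequence V E (partial_switch E h1 h2 (set (qs @ [p]))) (map (\<lambda>(u, v). {u, v}) rs) h2"
    using Cons.IH[of "qs @ [p]"] Cons.prems by simp
  ultimately show ?case using p by auto
qed

lemma flip_sequence_sorted: "flip_sequence V E h1 (map (\<lambda>(u, v). {u, v}) ps) h2"
proof -
  have "partial_switch E h1 h2 {} e = h1 e" for e
    using ao1 by (cases "e \<in> E")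
      (auto simp: partial_switch_def acyclic_orientation_def orientation_def PiE_def extensional_def)
  then have "partial_switch E h1 h2 {} = h1" by auto
  then show ?thesis using flip_sequence_partial_switch[of "[]" ps] by simp
qed

text \<open>Pairs are images of edges with two different heads, so they are no more numerous than
  these edges. The sorted sequence itself shows that \<open>h1\<close> and \<open>h2\<close> are
  connected, as the lower bound requires.\<close>

lemma length_sorted_le: "length ps \<le> max_codegree V E * flip_dist V E h1 h2"
proof -
  have "finite E"
    using hyp finite_subset[of E "Pow V"] by (auto simp: hypergraph_def)
  have "length ps = card (head_pairs E h1 h2)"
    using dist set_ps distinct_card[of ps] by simp
  also have "head_pairs E h1 h2 = (\<lambda>e. (h1 e, h2 e)) ` {e \<in> E. h1 e \<noteq> h2 e}"
    by (auto simp: head_pairs_def)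
  also have "card \<dots> \<le> card {e \<in> E. h1 e \<noteq> h2 e}"
    using \<open>finite E\<close> by (intro card_image_le) auto
  also have "\<dots> \<le> max_codegree V E * flip_dist V E h1 h2"
    by (rule card_diff_le_flip_dist[OF hyp flip_sequence_sorted])
  finally show ?thesis .
qed

end

text \<open>The rank of a vertex is its number of proper ancestors: along an arc the tail itself is
  a new ancestor. The program computes ranks of its own; these serve as an upper bound on
  them.\<close>

lemma bounded_ranks_exist:
  assumes "acyclic_orientation E h" "finite (\<Union>E)"
  obtains d where "ranks E h d" "\<And>v. d v \<le> card (\<Union>E)"
proof
  let ?D = "arcs E h"
  let ?d = "\<lambda>v. card {u. (u, v) \<in> ?D\<^sup>+}"
  have acyc: "acyclic ?D" and h: "e \<in> E \<Longrightarrow> h e \<in> e" for e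
    using assms by (auto simp: acyclic_orientation_def orientation_def)
  have D: "?D \<subseteq> \<Union>E \<times> \<Union>E" using h by (auto simp: arcs_def)
  then have "?D\<^sup>+ \<subseteq> \<Union>E \<times> \<Union>E" by (simp add: trancl_subset_Sigma)
  then have sub: "{u. (u, v) \<in> ?D\<^sup>+} \<subseteq> \<Union>E" for v by auto
  then show "?d v \<le> card (\<Union>E)" for v using assms(2) by (intro card_mono) auto
  show "ranks E h ?d"
    unfolding ranks_def
  proof (intro ballI impI)
    fix e x
    assume "e \<in> E" "x \<in> e" "x \<noteq> h e"
    then have arc: "(x, h e) \<in> ?D" by (auto simp: arcs_def)
    have "x \<notin> {u. (u, x) \<in> ?D\<^sup>+}" using acyc by (auto simp: acyclic_def)
    then have "{u. (u, x) \<in> ?D\<^sup>+} \<subset> {u. (u, h e) \<in> ?D\<^sup>+}"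
      using arc by (auto intro: trancl_into_trancl)
    then show "?d x < ?d (h e)"
      by (rule psubset_card_mono[OF finite_subset[OF sub assms(2)]])
  qed
qed


section \<open>Counting steps instead of bits\<close>

inductive unit_exec :: "prog \<Rightarrow> config \<Rightarrow> nat \<Rightarrow> config \<Rightarrow> bool" where
  Skip: "unit_exec Skip s 1 s"
| Store: "unit_exec (Store a b) (m, inp, out) 1 (m(expr_val a m := expr_val b m), inp, out)"
| Read: "unit_exec (Read a) (m, x # inp, out) 1 (m(expr_val a m := x), inp, out)"
| Write: "unit_exec (Write a) (m, inp, out) 1 (m, inp, out @ [expr_val a m])"
| Seq: "unit_exec c s n s' \<Longrightarrow> unit_exec d s' k s'' \<Longrightarrow> unit_exec (Seq c d) s (n + k) s''"
| CondTrue: "expr_val b (fst s) \<noteq> 0 \<Longrightarrow> unit_exec c s n s' \<Longrightarrow> unit_exec (Cond b c d) s (1 + n) s'"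
| CondFalse: "expr_val b (fst s) = 0 \<Longrightarrow> unit_exec d s n s' \<Longrightarrow> unit_exec (Cond b c d) s (1 + n) s'"
| WhileFalse: "expr_val b (fst s) = 0 \<Longrightarrow> unit_exec (While b c) s 1 s"
| WhileTrue: "expr_val b (fst s) \<noteq> 0 \<Longrightarrow> unit_exec c s n s' \<Longrightarrow> unit_exec (While b c) s' k s'' \<Longrightarrow>
    unit_exec (While b c) s (1 + n + k) s''"

text \<open>The number of nodes, which bounds both the bits gained in an evaluation and the number
  of charges in \<open>expr_cost\<close>.\<close>

fun expr_size :: "expr \<Rightarrow> nat" where
  "expr_size (Const n) = 1"
| "expr_size (Load a) = expr_size a + 1"
| "expr_size (Add a b) = expr_size a + expr_size b + 1"
| "expr_size (Sub a b) = expr_size a + expr_size b + 1"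

fun expr_max :: "expr \<Rightarrow> nat" where
  "expr_max (Const n) = n"
| "expr_max (Load a) = expr_max a"
| "expr_max (Add a b) = max (expr_max a) (expr_max b)"
| "expr_max (Sub a b) = max (expr_max a) (expr_max b)"

fun exprs :: "prog \<Rightarrow> expr set" where
  "exprs Skip = {}"
| "exprs (Store a b) = {a, b}"
| "exprs (Read a) = {a}"
| "exprs (Write a) = {a}"
| "exprs (Seq c d) = exprs c \<union> exprs d"
| "exprs (Cond b c d) = {b} \<union> exprs c \<union> exprs d"
| "exprs (While b c) = {b} \<union> exprs c"

lemma finite_exprs: "finite (exprs c)"
  by (induction c) auto

text \<open>The condition \<open>b > 0\<close> reflects that 0 has bit length 1.\<close>

lemma bit_length_le:
  assumes "x < 2 ^ b" "b > 0"
  shows "bit_length x \<le> b"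
proof (cases "x = 0")
  case False
  have "(2::nat) ^ floor_log x \<le> x"
    using False by (intro floor_log_exp2_le) simp
  also have "\<dots> < 2 ^ b" by fact
  finally have "floor_log x < b"
    by (simp add: power_strict_increasing_iff)
  then show ?thesis by (simp add: bit_length_def)
qed (use assms in \<open>simp add: bit_length_def\<close>)

lemma less_power_bit_length: "x < 2 ^ bit_length x"
  using floor_log_exp2_gt[of x] by (simp add: bit_length_def)

lemma bit_length_pos: "bit_length x > 0"
  by (simp add: bit_length_def)

text \<open>An addition gains at most one bit over the longer operand, and loads and truncated
  subtractions create no larger numbers.\<close>

lemma expr_val_less:
  assumes "\<And>a. m a < 2 ^ L" "expr_max e < 2 ^ L"
  shows "expr_val e m < 2 ^ (L + expr_size e)"
  using assms(2)
proof (induction e)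
  case (Load e)
  have "m (expr_val e m) < 2 ^ L" by (rule assms)
  also have "\<dots> \<le> 2 ^ (L + expr_size (Load e))" by (rule power_increasing) auto
  finally show ?case by simp
next
  case (Add e f)
  have "(2::nat) ^ (L + expr_size e) \<le> 2 ^ (L + expr_size e + expr_size f)"
    "(2::nat) ^ (L + expr_size f) \<le> 2 ^ (L + expr_size e + expr_size f)"
    by (rule power_increasing; simp)+
  moreover have "(2::nat) ^ (L + expr_size (Add e f)) = 2 * 2 ^ (L + expr_size e + expr_size f)"
    by (simp add: add.assoc)
  ultimately show ?case
    using Add by (simp only: expr_val.simps expr_max.simps max_less_iff_conj True_implies_equals)
next
  case (Sub e f)
  have "expr_val (Sub e f) m \<le> expr_val e m" by simp
  also have "\<dots> < 2 ^ (L + expr_size e)" using Sub by simp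
  also have "\<dots> \<le> 2 ^ (L + expr_size (Sub e f))" by (rule power_increasing) auto
  finally show ?case .
qed simp

lemma expr_size_pos: "expr_size e > 0"
  by (induction e) auto

lemma expr_cost_le:
  assumes m: "\<And>a. m a < 2 ^ L" and "expr_max e < 2 ^ L"
  shows "expr_cost e m \<le> expr_size e * (L + expr_size e)"
proof -
  have len: "bit_length (expr_val e m) \<le> L + expr_size e" if "expr_max e < 2 ^ L" for e
    using expr_val_less[OF m that] expr_size_pos[of e] by (intro bit_length_le) auto
  show ?thesis using assms(2)
  proof (induction e)
    case (Const n)
    then show ?case using len[of "Const n"] by simp
  next
    case (Load e)
    then show ?case using len[of "Load e"] by (simp add: algebra_simps)
  next
    case (Add e f)
    then show ?case using len[of "Add e f"] by (simp add: algebra_simps)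
  next
    case (Sub e f)
    then show ?case using len[of "Sub e f"] by (simp add: algebra_simps)
  qed
qed

text \<open>The remaining input counts, since its symbols may enter the memory; the output is never
  read back.\<close>

definition vals_less :: "nat \<Rightarrow> config \<Rightarrow> bool" where
  "vals_less B s \<longleftrightarrow> (\<forall>a. fst s a < B) \<and> (\<forall>x\<in>set (fst (snd s)). x < B)"

lemma vals_less_mono: "vals_less B s \<Longrightarrow> B \<le> B' \<Longrightarrow> vals_less B' s"
  by (auto simp: vals_less_def intro: less_le_trans)

text \<open>Since the arithmetic only adds and subtracts, \<open>n\<close> steps lengthen the numbers by at most
  \<open>O(n)\<close> bits. Hence it suffices to count steps.\<close>

lemma unit_exec_imp_exec:
  assumes "unit_exec c s n s'"
    and "\<And>e. e \<in> exprs c \<Longrightarrow> expr_size e \<le> K \<and> expr_max e < 2 ^ L"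
    and "K > 0" "vals_less (2 ^ L) s" "L + K * n \<le> Z"
  shows "vals_less (2 ^ (L + K * n)) s' \<and> (\<exists>t. exec c s t s' \<and> t \<le> n * (2 * K * Z))"
  using assms
\<comment> \<open>\<open>L\<close> grows along the run, as the second part of a sequence starts with
  longer numbers, while \<open>Z\<close> stays fixed and bounds the lengths throughout. The factor 2
  pays for the two expressions of a \<open>Store\<close>, or for address and symbol of a
  \<open>Read\<close>.\<close>
proof (induction arbitrary: L rule: unit_exec.induct)
  case (Skip s)
  have "vals_less (2 ^ (L + K)) s"
    using Skip(3) by (rule vals_less_mono) (simp add: power_increasing)
  moreover have "1 \<le> 2 * K * Z" using Skip by simp
  ultimately show ?case using exec.Skip[of s] by auto
next
  case (Store a b m inp out)
  have m: "m x < 2 ^ L" for x using Store by (auto simp: vals_less_def)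
  have c: "expr_cost e m \<le> K * Z" "expr_val e m < 2 ^ (L + K)" if "e \<in> {a, b}" for e
  proof -
    have e: "expr_size e \<le> K" "expr_max e < 2 ^ L" using that Store(1)[of e] by auto
    have "expr_cost e m \<le> expr_size e * (L + expr_size e)"
      by (rule expr_cost_le[OF m e(2)])
    also have "\<dots> \<le> K * Z"
      using e Store(4) by (intro mult_mono) auto
    finally show "expr_cost e m \<le> K * Z" .
    have "expr_val e m < 2 ^ (L + expr_size e)" by (rule expr_val_less[OF m e(2)])
    also have "\<dots> \<le> 2 ^ (L + K)" using e by (intro power_increasing) auto
    finally show "expr_val e m < 2 ^ (L + K)" .
  qed
  have "vals_less (2 ^ (L + K)) (m(expr_val a m := expr_val b m), inp, out)"
    using vals_less_mono[OF Store(3), of "2 ^ (L + K)"] c(2)[of b]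
    by (simp add: vals_less_def power_increasing)
  moreover have "expr_cost a m + expr_cost b m \<le> 2 * K * Z"
    using c(1)[of a] c(1)[of b] by simp
  ultimately show ?case using exec.Store[of a b m inp out] by auto
next
  case (Read a m x inp out)
  have m: "m x < 2 ^ L" for x using Read by (auto simp: vals_less_def)
  have e: "expr_size a \<le> K" "expr_max a < 2 ^ L" using Read(1)[of a] by auto
  have "expr_cost a m \<le> expr_size a * (L + expr_size a)"
    by (rule expr_cost_le[OF m e(2)])
  also have "\<dots> \<le> K * Z"
    using e Read(4) by (intro mult_mono) auto
  finally have 1: "expr_cost a m \<le> K * Z" .
  have "x < 2 ^ L" using Read(3) by (simp add: vals_less_def)
  also have "\<dots> \<le> 2 ^ Z" using Read(4) by (intro power_increasing) auto
  finally have "bit_length x \<le> Z" using Read by (intro bit_length_le) auto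
  also have "\<dots> \<le> K * Z" using Read by simp
  finally have "expr_cost a m + bit_length x \<le> 2 * K * Z" using 1 by simp
  moreover have "vals_less (2 ^ (L + K)) (m(expr_val a m := x), inp, out)"
    using vals_less_mono[OF Read(3), of "2 ^ (L + K)"]
    by (simp add: vals_less_def power_increasing)
  ultimately show ?case using exec.Read[of a m x inp out] by auto
next
  case (Write a m inp out)
  have m: "m x < 2 ^ L" for x using Write by (auto simp: vals_less_def)
  have e: "expr_size a \<le> K" "expr_max a < 2 ^ L" using Write(1)[of a] by auto
  have "expr_cost a m \<le> expr_size a * (L + expr_size a)"
    by (rule expr_cost_le[OF m e(2)])
  also have "\<dots> \<le> 2 * K * Z"
    using e Write(4) by (intro mult_mono) auto
  finally have 1: "expr_cost a m \<le> 2 * K * Z" .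
  moreover have "vals_less (2 ^ (L + K)) (m, inp, out @ [expr_val a m])"
    using vals_less_mono[OF Write(3), of "2 ^ (L + K)"]
    by (simp add: vals_less_def power_increasing)
  ultimately show ?case using exec.Write[of a m inp out] by auto
next
  case (Seq c s n s' d k s'')
  have "vals_less (2 ^ (L + K * n)) s' \<and> (\<exists>t. exec c s t s' \<and> t \<le> n * (2 * K * Z))"
    using Seq.prems by (intro Seq.IH(1)) (auto simp: algebra_simps)
  then obtain t where t: "vals_less (2 ^ (L + K * n)) s'" "exec c s t s'" "t \<le> n * (2 * K * Z)"
    by blast
  have ex: "expr_size e \<le> K \<and> expr_max e < 2 ^ (L + K * n)" if "e \<in> exprs d" for e
    using Seq.prems(1)[of e] that power_increasing[of L "L + K * n" "2::nat"]
    by (auto intro: less_le_trans)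
  have "vals_less (2 ^ (L + K * n + K * k)) s'' \<and> (\<exists>t. exec d s' t s'' \<and> t \<le> k * (2 * K * Z))"
    using Seq.prems ex t by (intro Seq.IH(2)) (auto simp: algebra_simps)
  then obtain u where u: "vals_less (2 ^ (L + K * n + K * k)) s''" "exec d s' u s''" "u \<le> k * (2 * K * Z)"
    by blast
  have "t + u \<le> (n + k) * (2 * K * Z)"
    unfolding add_mult_distrib using t u by linarith
  then show ?case using exec.Seq[OF t(2) u(2)] u(1) by (auto simp: algebra_simps)
next
  case (CondTrue b s c n s' d)
  have IH: "vals_less (2 ^ (L + K * n)) s' \<and> (\<exists>t. exec c s t s' \<and> t \<le> n * (2 * K * Z))"
    using CondTrue.prems by (intro CondTrue.IH) (auto simp: algebra_simps)
  then obtain t where t: "vals_less (2 ^ (L + K * n)) s'" "exec c s t s'" "t \<le> n * (2 * K * Z)"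
    by blast
  have m: "fst s x < 2 ^ L" for x using CondTrue.prems by (auto simp: vals_less_def)
  have e: "expr_size b \<le> K" "expr_max b < 2 ^ L" using CondTrue.prems(1)[of b] by auto
  have "expr_cost b (fst s) \<le> expr_size b * (L + expr_size b)"
    by (rule expr_cost_le[OF m e(2)])
  also have "\<dots> \<le> 2 * K * Z"
    using e CondTrue.prems(4) by (intro mult_mono) auto
  finally have "expr_cost b (fst s) + t \<le> (1 + n) * (2 * K * Z)"
    unfolding add_mult_distrib using t by linarith
  moreover have "vals_less (2 ^ (L + K * (1 + n))) s'"
    using t(1) by (rule vals_less_mono) (simp add: power_increasing)
  ultimately show ?case using exec.CondTrue[OF CondTrue.hyps(1) t(2)] by blast
next
  case (CondFalse b s d n s' c)
  have IH: "vals_less (2 ^ (L + K * n)) s' \<and> (\<exists>t. exec d s t s' \<and> t \<le> n * (2 * K * Z))"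
    using CondFalse.prems by (intro CondFalse.IH) (auto simp: algebra_simps)
  then obtain t where t: "vals_less (2 ^ (L + K * n)) s'" "exec d s t s'" "t \<le> n * (2 * K * Z)"
    by blast
  have m: "fst s x < 2 ^ L" for x using CondFalse.prems by (auto simp: vals_less_def)
  have e: "expr_size b \<le> K" "expr_max b < 2 ^ L" using CondFalse.prems(1)[of b] by auto
  have "expr_cost b (fst s) \<le> expr_size b * (L + expr_size b)"
    by (rule expr_cost_le[OF m e(2)])
  also have "\<dots> \<le> 2 * K * Z"
    using e CondFalse.prems(4) by (intro mult_mono) auto
  finally have "expr_cost b (fst s) + t \<le> (1 + n) * (2 * K * Z)"
    unfolding add_mult_distrib using t by linarith
  moreover have "vals_less (2 ^ (L + K * (1 + n))) s'"
    using t(1) by (rule vals_less_mono) (simp add: power_increasing)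
  ultimately show ?case using exec.CondFalse[OF CondFalse.hyps(1) t(2)] by blast
next
  case (WhileFalse b s c)
  have m: "fst s x < 2 ^ L" for x using WhileFalse.prems by (auto simp: vals_less_def)
  have e: "expr_size b \<le> K" "expr_max b < 2 ^ L" using WhileFalse.prems(1)[of b] by auto
  have "expr_cost b (fst s) \<le> expr_size b * (L + expr_size b)"
    by (rule expr_cost_le[OF m e(2)])
  also have "\<dots> \<le> 2 * K * Z"
    using e WhileFalse.prems(4) by (intro mult_mono) auto
  finally have "expr_cost b (fst s) \<le> 1 * (2 * K * Z)" by simp
  moreover have "vals_less (2 ^ (L + K * 1)) s"
    using WhileFalse.prems(3) by (rule vals_less_mono) (simp add: power_increasing)
  ultimately show ?case using exec.WhileFalse[OF WhileFalse.hyps(1)] by blast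
next
  case (WhileTrue b s c n s' k s'')
  have "vals_less (2 ^ (L + K * n)) s' \<and> (\<exists>t. exec c s t s' \<and> t \<le> n * (2 * K * Z))"
    using WhileTrue.prems by (intro WhileTrue.IH(1)) (auto simp: algebra_simps)
  then obtain t where t: "vals_less (2 ^ (L + K * n)) s'" "exec c s t s'" "t \<le> n * (2 * K * Z)"
    by blast
  have ex: "expr_size e \<le> K \<and> expr_max e < 2 ^ (L + K * n)" if "e \<in> exprs (While b c)" for e
    using WhileTrue.prems(1)[of e] that power_increasing[of L "L + K * n" "2::nat"]
    by (auto intro: less_le_trans)
  have "vals_less (2 ^ (L + K * n + K * k)) s'' \<and>
      (\<exists>t. exec (While b c) s' t s'' \<and> t \<le> k * (2 * K * Z))"
    using WhileTrue.prems ex t by (intro WhileTrue.IH(2)) (auto simp: algebra_simps)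
  then obtain u where u: "vals_less (2 ^ (L + K * n + K * k)) s''" "exec (While b c) s' u s''"
      "u \<le> k * (2 * K * Z)"
    by blast
  have m: "fst s x < 2 ^ L" for x using WhileTrue.prems by (auto simp: vals_less_def)
  have e: "expr_size b \<le> K" "expr_max b < 2 ^ L" using WhileTrue.prems(1)[of b] by auto
  have "expr_cost b (fst s) \<le> expr_size b * (L + expr_size b)"
    by (rule expr_cost_le[OF m e(2)])
  also have "\<dots> \<le> 2 * K * Z"
    using e WhileTrue.prems(4) by (intro mult_mono) auto
  finally have "expr_cost b (fst s) + t + u \<le> (1 + n + k) * (2 * K * Z)"
    unfolding add_mult_distrib using t u by linarith
  moreover have "L + K * (1 + n + k) = (L + K * n + K * k) + K" by (simp add: algebra_simps)
  then have "vals_less (2 ^ (L + K * (1 + n + k))) s''"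
    using vals_less_mono[OF u(1)] by (simp add: power_increasing)
  ultimately show ?case using exec.WhileTrue[OF WhileTrue.hyps(1) t(2) u(2)] by blast
qed

lemma member_le_tape_size: "x \<in> set w \<Longrightarrow> bit_length x \<le> tape_size w"
  by (induction w) (auto simp: tape_size_def)

text \<open>Every symbol, 0 included, costs at least one bit.\<close>

lemma length_le_tape_size: "length w \<le> tape_size w"
proof (induction w)
  case (Cons x w)
  then show ?case using bit_length_pos[of x] by (simp add: tape_size_def)
qed (simp add: tape_size_def)

lemma poly_time_if_poly_steps:
  fixes q :: "nat poly"
  shows "\<exists>p :: nat poly. \<forall>w n m inp out. unit_exec A (\<lambda>_. 0, w, []) n (m, inp, out) \<longrightarrow>
    n \<le> poly q (tape_size w) \<longrightarrow> (\<exists>t. runs A w t out \<and> t \<le> poly p (tape_size w))"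
proof -
  define K where "K = 1 + (\<Sum>e\<in>exprs A. expr_size e)"
  define C where "C = (\<Sum>e\<in>exprs A. expr_max e)"
  \<comment> \<open>This is the cost bound for \<open>L = C + S\<close> and
    \<open>Z = L + K * n\<close>, with \<open>n\<close> replaced by \<open>q\<close>:
    \<open>C\<close> bits suffice for the constants of the program and \<open>S\<close> bits for the
    input.\<close>
  define p where "p = q * (smult (2 * K) ([:C, 1:] + smult K q))"
  have "\<exists>t. runs A w t out \<and> t \<le> poly p (tape_size w)"
    if ex: "unit_exec A (\<lambda>_. 0, w, []) n (m, inp, out)" and n: "n \<le> poly q (tape_size w)"
    for w n m inp out
  proof -
    define S where "S = tape_size w"
    have "x < 2 ^ (C + S)" if "x \<in> set w" for x
    proof -
      have "x < 2 ^ bit_length x" by (rule less_power_bit_length)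
      also have "\<dots> \<le> 2 ^ (C + S)"
        using member_le_tape_size[OF that] by (intro power_increasing) (auto simp: S_def)
      finally show ?thesis .
    qed
    then have v: "vals_less (2 ^ (C + S)) (\<lambda>_. 0, w, [])"
      by (simp add: vals_less_def)
    have b: "expr_size e \<le> K \<and> expr_max e < 2 ^ (C + S)" if "e \<in> exprs A" for e
    proof
      show "expr_size e \<le> K"
        using member_le_sum[OF that, of expr_size] finite_exprs by (simp add: K_def)
      have "expr_max e \<le> C"
        using member_le_sum[OF that, of expr_max] finite_exprs by (simp add: C_def)
      also have "C < 2 ^ C" by simp
      also have "\<dots> \<le> 2 ^ (C + S)" by (rule power_increasing) auto
      finally show "expr_max e < 2 ^ (C + S)" .
    qed
    obtain t where t: "exec A (\<lambda>_. 0, w, []) t (m, inp, out)" "t \<le> n * (2 * K * (C + S + K * n))"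
      using unit_exec_imp_exec[OF ex b _ v order_refl] by (auto simp: K_def)
    note t(2)
    also have "n * (2 * K * (C + S + K * n)) \<le> poly q S * (2 * K * (C + S + K * poly q S))"
      using n unfolding S_def[symmetric] by (intro mult_mono add_mono) auto
    also have "\<dots> = poly p S" by (simp add: p_def)
    finally show ?thesis using t(1) by (auto simp: runs_def S_def)
  qed
  then show ?thesis by blast
qed


section \<open>Hoare triples with step bounds\<close>

type_synonym assertion = "memory \<Rightarrow> nat list \<Rightarrow> nat list \<Rightarrow> bool"

definition triple :: "assertion \<Rightarrow> prog \<Rightarrow> nat \<Rightarrow> assertion \<Rightarrow> bool" where
  "triple P c T Q \<longleftrightarrow> (\<forall>m inp out. P m inp out \<longrightarrow>
     (\<exists>n m' inp' out'. unit_exec c (m, inp, out) n (m', inp', out') \<and> n \<le> T \<and> Q m' inp' out'))"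

fun prog_size :: "prog \<Rightarrow> nat" where
  "prog_size (Seq c d) = prog_size c + prog_size d"
| "prog_size (Cond b c d) = 1 + prog_size c + prog_size d"
| "prog_size _ = 1"

text \<open>Only meant for loop-free programs.\<close>

fun wp :: "prog \<Rightarrow> assertion \<Rightarrow> assertion" where
  "wp Skip Q m inp out \<longleftrightarrow> Q m inp out"
| "wp (Store a b) Q m inp out \<longleftrightarrow> Q (m(expr_val a m := expr_val b m)) inp out"
| "wp (Read a) Q m inp out \<longleftrightarrow> inp \<noteq> [] \<and> Q (m(expr_val a m := hd inp)) (tl inp) out"
| "wp (Write a) Q m inp out \<longleftrightarrow> Q m inp (out @ [expr_val a m])"
| "wp (Seq c d) Q m inp out \<longleftrightarrow> wp c (wp d Q) m inp out"
| "wp (Cond b c d) Q m inp out \<longleftrightarrow> (if expr_val b m \<noteq> 0 then wp c Q m inp out else wp d Q m inp out)"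
| "wp (While b c) Q m inp out \<longleftrightarrow> False"

lemma wp_sound:
  "wp c Q m inp out \<Longrightarrow>
    \<exists>n m' inp' out'. unit_exec c (m, inp, out) n (m', inp', out') \<and> n \<le> prog_size c \<and> Q m' inp' out'"
proof (induction c arbitrary: Q m inp out)
  case Skip
  then show ?case by (intro exI conjI) (rule unit_exec.Skip, auto)
next
  case (Store a b)
  then show ?case by (intro exI conjI) (rule unit_exec.Store, simp_all add: fun_upd_def)
next
  case (Read a)
  then obtain x xs where "inp = x # xs" by (cases inp) auto
  with Read show ?case by (simp only:, intro exI conjI) (rule unit_exec.Read, simp_all add: fun_upd_def)
next
  case (Write a)
  then show ?case by (intro exI conjI) (rule unit_exec.Write, auto)
next
  case (Seq c d)
  obtain n m1 inp1 out1 where 1: "unit_exec c (m, inp, out) n (m1, inp1, out1)" "n \<le> prog_size c"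
      "wp d Q m1 inp1 out1"
    using Seq.IH(1)[of "wp d Q" m inp out] Seq.prems by auto
  obtain k m2 inp2 out2 where 2: "unit_exec d (m1, inp1, out1) k (m2, inp2, out2)" "k \<le> prog_size d"
      "Q m2 inp2 out2"
    using Seq.IH(2)[OF 1(3)] by auto
  show ?case using unit_exec.Seq[OF 1(1) 2(1)] 1 2
    by (intro exI[of _ "n + k"] exI[of _ m2] exI[of _ inp2] exI[of _ out2]) auto
next
  case (Cond b c d)
  show ?case
  proof (cases "expr_val b m = 0")
    case True
    then obtain k m2 inp2 out2 where 2: "unit_exec d (m, inp, out) k (m2, inp2, out2)"
        "k \<le> prog_size d" "Q m2 inp2 out2"
      using Cond.IH(2)[of Q m inp out] Cond.prems by auto
    show ?thesis using unit_exec.CondFalse[of b "(m, inp, out)", OF _ 2(1)] True 2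
      by (intro exI[of _ "1 + k"] exI[of _ m2] exI[of _ inp2] exI[of _ out2]) auto
  next
    case False
    then obtain k m2 inp2 out2 where 2: "unit_exec c (m, inp, out) k (m2, inp2, out2)"
        "k \<le> prog_size c" "Q m2 inp2 out2"
      using Cond.IH(1)[of Q m inp out] Cond.prems by auto
    show ?thesis using unit_exec.CondTrue[of b "(m, inp, out)", OF _ 2(1)] False 2
      by (intro exI[of _ "1 + k"] exI[of _ m2] exI[of _ inp2] exI[of _ out2]) auto
  qed
qed simp

lemma triple_wp:
  assumes "\<And>m inp out. P m inp out \<Longrightarrow> wp c Q m inp out" "prog_size c \<le> T"
  shows "triple P c T Q"
  unfolding triple_def
proof (intro allI impI)
  fix m inp out
  assume "P m inp out"
  from wp_sound[OF assms(1)[OF this]] assms(2)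
  show "\<exists>n m' inp' out'. unit_exec c (m, inp, out) n (m', inp', out') \<and> n \<le> T \<and> Q m' inp' out'"
    by (meson order_trans)
qed

lemma triple_Seq:
  assumes "triple P c T R" "triple R d T' Q"
  shows "triple P (Seq c d) (T + T') Q"
  unfolding triple_def
proof (intro allI impI)
  fix m inp out
  assume "P m inp out"
  then obtain n m1 inp1 out1 where 1: "unit_exec c (m, inp, out) n (m1, inp1, out1)" "n \<le> T"
      "R m1 inp1 out1"
    using assms(1) unfolding triple_def by blast
  then obtain k m2 inp2 out2 where 2: "unit_exec d (m1, inp1, out1) k (m2, inp2, out2)" "k \<le> T'"
      "Q m2 inp2 out2"
    using assms(2) unfolding triple_def by blast
  show "\<exists>n m' inp' out'. unit_exec (Seq c d) (m, inp, out) n (m', inp', out') \<and> n \<le> T + T' \<and>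
      Q m' inp' out'"
    using unit_exec.Seq[OF 1(1) 2(1)] 1 2
    by (intro exI[of _ "n + k"] exI[of _ m2] exI[of _ inp2] exI[of _ out2]) auto
qed

lemma triple_conseq:
  assumes "triple P c T Q"
    and "\<And>m inp out. P' m inp out \<Longrightarrow> P m inp out"
    and "\<And>m inp out. Q m inp out \<Longrightarrow> Q' m inp out" "T \<le> T'"
  shows "triple P' c T' Q'"
  using assms unfolding triple_def by (meson order_trans)

text \<open>The variable \<open>k\<close> records the measure before the body, so that the
  postcondition can express its decrease. Each round pays for the body and one test; the last
  summand 1 is the failing test.\<close>

lemma triple_While:
  fixes \<mu> :: "memory \<Rightarrow> nat"
  assumes body: "\<And>k. triple (\<lambda>m inp out. I m inp out \<and> expr_val b m \<noteq> 0 \<and> \<mu> m = k) c T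
      (\<lambda>m inp out. I m inp out \<and> \<mu> m < k)"
    and bound: "\<And>m inp out. P m inp out \<Longrightarrow> I m inp out \<and> \<mu> m \<le> n"
    and exit: "\<And>m inp out. I m inp out \<Longrightarrow> expr_val b m = 0 \<Longrightarrow> Q m inp out"
  shows "triple P (While b c) (n * (T + 1) + 1) Q"
proof -
  have "\<exists>n m' inp' out'. unit_exec (While b c) (m, inp, out) n (m', inp', out') \<and>
      n \<le> k * (T + 1) + 1 \<and> Q m' inp' out'" if "I m inp out" "\<mu> m \<le> k" for k m inp out
    using that
  proof (induction k arbitrary: m inp out)
    case k: (0 m inp out)
    show ?case
    proof (cases "expr_val b m = 0")
      case True
      then show ?thesis using unit_exec.WhileFalse[of b "(m, inp, out)" c] exit[OF k(1)] by auto
    next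
      case False
      \<comment> \<open>Impossible: the body would end with a measure below 0.\<close>
      then show ?thesis using body[of "\<mu> m"] k unfolding triple_def
        by (metis less_nat_zero_code le_zero_eq)
    qed
  next
    case (Suc k m inp out)
    show ?case
    proof (cases "expr_val b m = 0")
      case True
      then show ?thesis
        using unit_exec.WhileFalse[of b "(m, inp, out)" c] exit[OF Suc.prems(1)]
        by (intro exI[of _ 1]) auto
    next
      case False
      then obtain n m1 inp1 out1 where 1: "unit_exec c (m, inp, out) n (m1, inp1, out1)" "n \<le> T"
          "I m1 inp1 out1" "\<mu> m1 < \<mu> m"
        using body[of "\<mu> m"] Suc.prems unfolding triple_def by blast
      moreover have "\<mu> m1 \<le> k" using 1(4) Suc.prems(2) by simp
      ultimately obtain j m2 inp2 out2 where 2: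
          "unit_exec (While b c) (m1, inp1, out1) j (m2, inp2, out2)" "j \<le> k * (T + 1) + 1"
          "Q m2 inp2 out2"
        using Suc.IH by blast
      show ?thesis using unit_exec.WhileTrue[of b "(m, inp, out)", OF _ 1(1) 2(1)] False 1(2) 2
        by (intro exI[of _ "1 + n + j"] exI[of _ m2] exI[of _ inp2] exI[of _ out2]) auto
    qed
  qed
  then show ?thesis using bound unfolding triple_def by blast
qed

lemma triple_ex:
  "(\<And>x. triple (P x) c T Q) \<Longrightarrow> triple (\<lambda>m inp out. \<exists>x. P x m inp out) c T Q"
  unfolding triple_def by blast

lemma triple_conj:
  assumes "C \<Longrightarrow> triple P c T Q"
  shows "triple (\<lambda>m inp out. C \<and> P m inp out) c T (\<lambda>m inp out. C \<and> Q m inp out)"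
  using assms unfolding triple_def by blast

text \<open>Makes the initial memory available as a constant \<open>m0\<close>, to which later
  assertions may refer.\<close>

lemma triple_fix:
  "(\<And>m0. P' m0 \<Longrightarrow> triple (\<lambda>m inp out. P m inp out \<and> m = m0) c T Q) \<Longrightarrow>
    (\<And>m inp out. P m inp out \<Longrightarrow> P' m) \<Longrightarrow> triple P c T Q"
  unfolding triple_def by blast


section \<open>The program\<close>

notation Seq (infixr ";;" 60)

text \<open>The registers are organised into eight arrays; array \<open>0\<close> holds the scalar variables.\<close>

definition cell :: "nat \<Rightarrow> nat \<Rightarrow> nat" where
  "cell c i = 8 * i + c"

text \<open>Multiplication by 8 as three doublings, since the machine can only add and
  subtract.\<close>

definition addr :: "nat \<Rightarrow> expr \<Rightarrow> expr" where
  "addr c e = (let d = Add e e; q = Add d d in Add (Add q q) (Const c))"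

definition arr :: "nat \<Rightarrow> expr \<Rightarrow> expr" where
  "arr c e = Load (addr c e)"

abbreviation var :: "nat \<Rightarrow> expr" where
  "var k \<equiv> arr 0 (Const k)"

abbreviation set_arr :: "nat \<Rightarrow> expr \<Rightarrow> expr \<Rightarrow> prog" where
  "set_arr c e \<equiv> Store (addr c e)"

abbreviation set_var :: "nat \<Rightarrow> expr \<Rightarrow> prog" where
  "set_var k \<equiv> Store (addr 0 (Const k))"

abbreviation read_var :: "nat \<Rightarrow> prog" where
  "read_var k \<equiv> Read (addr 0 (Const k))"

abbreviation incr :: "nat \<Rightarrow> prog" where
  "incr k \<equiv> set_var k (Add (var k) (Const 1))"

abbreviation decr :: "nat \<Rightarrow> prog" where
  "decr k \<equiv> set_var k (Sub (var k) (Const 1))"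

text \<open>One of the two truncated differences is 0, so the sum is the distance of the
  values.\<close>

definition neq :: "expr \<Rightarrow> expr \<Rightarrow> expr" where
  "neq a b = Add (Sub a b) (Sub b a)"

lemma expr_val_addr [simp]: "expr_val (addr c e) m = cell c (expr_val e m)"
  by (simp add: addr_def cell_def Let_def)

lemma expr_val_arr [simp]: "expr_val (arr c e) m = m (cell c (expr_val e m))"
  by (simp add: arr_def)

lemma expr_val_neq [simp]: "expr_val (neq a b) m = 0 \<longleftrightarrow> expr_val a m = expr_val b m"
  by (auto simp: neq_def)

lemma cell_eq [simp]: "c < 8 \<Longrightarrow> c' < 8 \<Longrightarrow> cell c i = cell c' i' \<longleftrightarrow> c = c' \<and> i = i'"
proof
  assume "c < 8" "c' < 8" "cell c i = cell c' i'"
  then show "c = c' \<and> i = i'"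
    unfolding cell_def by (metis div_less div_mult_self4 mod_less mod_mult_self4 add_0_right zero_neq_numeral)
qed simp

abbreviation (input) "n_inc \<equiv> 0 :: nat"
abbreviation (input) "n_edge \<equiv> 1 :: nat"
abbreviation (input) "idx \<equiv> 2 :: nat"
abbreviation (input) "cnt \<equiv> 3 :: nat"
abbreviation (input) "changed \<equiv> 4 :: nat"
abbreviation (input) "best_u \<equiv> 5 :: nat"
abbreviation (input) "best_v \<equiv> 6 :: nat"

text \<open>The \<open>i\<close>-th pair of a vertex and an edge containing it consists of the vertex
  \<open>vert_arr i\<close> and the edge with number \<open>edge_arr i\<close>. The head arrays are indexed by edge
  numbers, the rank arrays by the vertices themselves.\<close>

abbreviation (input) "vert_arr \<equiv> 1 :: nat"
abbreviation (input) "edge_arr \<equiv> 2 :: nat"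
abbreviation (input) "head1_arr \<equiv> 3 :: nat"
abbreviation (input) "head2_arr \<equiv> 4 :: nat"
abbreviation (input) "rank1_arr \<equiv> 5 :: nat"
abbreviation (input) "rank2_arr \<equiv> 6 :: nat"

definition skip_vertices :: prog where
  "skip_vertices = read_var cnt ;; While (var cnt) (read_var idx ;; decr cnt)"

definition read_elem :: prog where
  "read_elem = Read (addr vert_arr (var n_inc)) ;; set_arr edge_arr (var n_inc) (var idx) ;;
     incr n_inc ;; decr cnt"

definition read_edge :: prog where
  "read_edge = read_var cnt ;; While (var cnt) read_elem ;;
     Read (addr head1_arr (var idx)) ;; Read (addr head2_arr (var idx)) ;; incr idx"

text \<open>Truncated subtraction serves as strict comparison, here and below: the loop condition
  holds iff \<open>idx\<close> is less than \<open>n_edge\<close>.\<close>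

definition read_edges :: prog where
  "read_edges = (set_var idx (Const 0) ;; read_var n_edge) ;;
     While (Sub (var n_edge) (var idx)) read_edge"

text \<open>Ranks are computed as in the Bellman-Ford algorithm for longest paths: as long as some arc
  does not increase the rank, the rank of its target is raised.\<close>

definition relax :: "nat \<Rightarrow> nat \<Rightarrow> prog" where
  "relax h r =
     (let x = arr vert_arr (var idx); y = arr h (arr edge_arr (var idx)) in
      Cond (neq x y)
        (Cond (Sub (Add (arr r x) (Const 1)) (arr r y))
          (set_arr r y (Add (arr r x) (Const 1)) ;; set_var changed (Const 1)) Skip) Skip ;;
      incr idx)"

definition rank_pass :: "nat \<Rightarrow> nat \<Rightarrow> prog" where
  "rank_pass h r = (set_var changed (Const 0) ;; set_var idx (Const 0)) ;;
     While (Sub (var n_inc) (var idx)) (relax h r)"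

definition compute_ranks :: "nat \<Rightarrow> nat \<Rightarrow> prog" where
  "compute_ranks h r = set_var changed (Const 1) ;; While (var changed) (rank_pass h r)"

text \<open>One step of a linear search for a least pair under \<open>flip_before\<close>. The
  candidate is replaced on strict improvement, or if its components are equal, which means that none
  has been found yet.\<close>

definition improve :: prog where
  "improve =
     (let u = arr head1_arr (var idx); v = arr head2_arr (var idx);
          u' = var best_u; v' = var best_v;
          take = set_var best_u u ;; set_var best_v v in
      Cond (neq u v)
        (Cond (neq u' v')
          (Cond (Sub (arr rank2_arr v) (arr rank2_arr v')) take
            (Cond (Sub (arr rank2_arr v') (arr rank2_arr v)) Skip
              (Cond (Sub v' v) take
                (Cond (Sub v v') Skip
                  (Cond (Sub (arr rank1_arr u') (arr rank1_arr u)) take Skip)))))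
          take)
        Skip ;;
      incr idx)"

definition select_best :: prog where
  "select_best = (set_var best_u (Const 0) ;; set_var best_v (Const 0) ;; set_var idx (Const 0)) ;;
     While (Sub (var n_edge) (var idx)) improve"

text \<open>An edge is retired by overwriting its first head with its second one.\<close>

definition retire :: prog where
  "retire =
     (let u = arr head1_arr (var idx); v = arr head2_arr (var idx) in
      Cond (Add (neq u (var best_u)) (neq v (var best_v))) Skip (set_arr head1_arr (var idx) v) ;;
      incr idx)"

definition emit :: prog where
  "emit = (Write (var best_u) ;; Write (var best_v) ;; set_var idx (Const 0)) ;;
     While (Sub (var n_edge) (var idx)) retire"

definition sort_pairs :: prog where
  "sort_pairs = select_best ;; While (neq (var best_u) (var best_v)) (emit ;; select_best)"

definition flip_program :: prog where
  "flip_program = skip_vertices ;; read_edges ;; compute_ranks head1_arr rank1_arr ;;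
     compute_ranks head2_arr rank2_arr ;; sort_pairs"


section \<open>Reading the input\<close>

text \<open>The incidence arrays are described as a set of pairs, because relaxation may visit the
  arcs in any order. The bound \<open>S\<close> limits the length of a pass.\<close>

definition loaded ::
  "nat list list \<Rightarrow> (nat set \<Rightarrow> nat) \<Rightarrow> (nat set \<Rightarrow> nat) \<Rightarrow> nat \<Rightarrow> memory \<Rightarrow> bool" where
  "loaded es h1 h2 S m \<longleftrightarrow>
     m (cell 0 n_inc) \<le> S \<and> m (cell 0 n_edge) = length es \<and>
     (\<lambda>i. (m (cell vert_arr i), m (cell edge_arr i))) ` {..<m (cell 0 n_inc)} =
       {(x, k). k < length es \<and> x \<in> set (es ! k)} \<and>
     (\<forall>k<length es. m (cell head1_arr k) = h1 (set (es ! k)) \<and> m (cell head2_arr k) = h2 (set (es ! k)))"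

lemma loaded_update [simp]:
  "2 \<le> k \<Longrightarrow> loaded es h1 h2 S (m(cell 0 k := v)) \<longleftrightarrow> loaded es h1 h2 S m"
  "5 \<le> c \<Longrightarrow> c < 8 \<Longrightarrow> loaded es h1 h2 S (m(cell c i := v)) \<longleftrightarrow> loaded es h1 h2 S m"
  by (simp_all add: loaded_def)

lemma loaded_incidence:
  assumes "loaded es h1 h2 S m" "i < m (cell 0 n_inc)"
  shows "m (cell edge_arr i) < length es" "m (cell vert_arr i) \<in> set (es ! m (cell edge_arr i))"
proof -
  have "(m (cell vert_arr i), m (cell edge_arr i)) \<in> {(x, k). k < length es \<and> x \<in> set (es ! k)}"
    using assms unfolding loaded_def by blast
  then show "m (cell edge_arr i) < length es" "m (cell vert_arr i) \<in> set (es ! m (cell edge_arr i))"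
    by auto
qed

definition incidences :: "memory \<Rightarrow> (nat \<times> nat) set" where
  "incidences m = (\<lambda>i. (m (cell vert_arr i), m (cell edge_arr i))) ` {..<m (cell 0 n_inc)}"

lemma incidences_cong:
  assumes "m' (cell 0 n_inc) = m (cell 0 n_inc)"
    "\<And>i. m' (cell vert_arr i) = m (cell vert_arr i)" "\<And>i. m' (cell edge_arr i) = m (cell edge_arr i)"
  shows "incidences m' = incidences m"
  using assms by (simp add: incidences_def)

lemma incidences_insert:
  assumes "N = m (cell 0 n_inc)"
  shows "incidences (m(cell vert_arr N := x, cell edge_arr N := k, cell 0 n_inc := Suc N,
    cell 0 cnt := c)) = insert (x, k) (incidences m)"
  using assms by (auto simp: incidences_def lessThan_Suc)

text \<open>What remains of the all-zero memory after the vertex list has been read, which changes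
  \<open>cnt\<close> and \<open>idx\<close>.\<close>

definition blank :: "memory \<Rightarrow> bool" where
  "blank m \<longleftrightarrow> (\<forall>c x. 0 < c \<longrightarrow> c < 8 \<longrightarrow> m (cell c x) = 0) \<and> m (cell 0 n_inc) = 0"

lemma blank_update [simp]: "k \<noteq> 0 \<Longrightarrow> blank (m(cell 0 k := v)) \<longleftrightarrow> blank m"
  by (simp add: blank_def)

locale tape =
  fixes es :: "nat list list" and h1 h2 :: "nat set \<Rightarrow> nat" and S :: nat
begin

definition rest :: "nat \<Rightarrow> nat list" where
  "rest j = concat (map (encode_edge h1 h2) (drop j es))"

lemma rest_step: "j < length es \<Longrightarrow> rest j = encode_edge h1 h2 (es ! j) @ rest (Suc j)"
  by (simp add: rest_def Cons_nth_drop_Suc[symmetric])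

text \<open>The first \<open>j\<close> edges are stored, and \<open>ys\<close> from edge
  \<open>j\<close>. Storing an incidence consumes an input symbol, so the sum in the last conjunct
  never grows; it yields the bound on \<open>n_inc\<close>.\<close>

definition read_state :: "nat \<Rightarrow> nat list \<Rightarrow> memory \<Rightarrow> nat list \<Rightarrow> nat list \<Rightarrow> bool" where
  "read_state j ys m inp out \<longleftrightarrow> m (cell 0 idx) = j \<and> m (cell 0 n_edge) = length es \<and>
     (\<forall>x. m (cell rank1_arr x) = 0 \<and> m (cell rank2_arr x) = 0) \<and> out = [] \<and>
     incidences m = {(x, k). k < j \<and> x \<in> set (es ! k)} \<union> set ys \<times> {j} \<and>
     (\<forall>k<j. m (cell head1_arr k) = h1 (set (es ! k)) \<and> m (cell head2_arr k) = h2 (set (es ! k))) \<and>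
     m (cell 0 n_inc) + length inp \<le> S"

definition elem_state :: "nat \<Rightarrow> memory \<Rightarrow> nat list \<Rightarrow> nat list \<Rightarrow> bool" where
  "elem_state j m inp out \<longleftrightarrow> (\<exists>ys zs. es ! j = ys @ zs \<and> length zs = m (cell 0 cnt) \<and>
     inp = zs @ [h1 (set (es ! j)), h2 (set (es ! j))] @ rest (Suc j) \<and> read_state j ys m inp out)"

lemma read_elem_correct:
  "triple (\<lambda>m inp out. elem_state j m inp out \<and> expr_val (var cnt) m \<noteq> 0 \<and> m (cell 0 cnt) = c)
     read_elem 4 (\<lambda>m inp out. elem_state j m inp out \<and> m (cell 0 cnt) < c)"
proof (rule triple_wp)
  fix m inp out
  assume A: "elem_state j m inp out \<and> expr_val (var cnt) m \<noteq> 0 \<and> m (cell 0 cnt) = c"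
  then obtain ys zs where *: "es ! j = ys @ zs" "length zs = m (cell 0 cnt)"
    "inp = zs @ [h1 (set (es ! j)), h2 (set (es ! j))] @ rest (Suc j)" "read_state j ys m inp out"
    by (auto simp: elem_state_def)
  then obtain z zs' where zs: "zs = z # zs'" using A by (cases zs) auto
  define N where "N = m (cell 0 n_inc)"
  define m' where "m' = m(cell vert_arr N := z, cell edge_arr N := j, cell 0 n_inc := Suc N,
    cell 0 cnt := m (cell 0 cnt) - 1)"
  have j: "m (cell 0 idx) = j" using *(4) by (simp add: read_state_def)
  have wp: "wp read_elem Q m inp out \<longleftrightarrow> Q m' (tl inp) out" for Q
    using j *(3) zs by (simp add: read_elem_def m'_def flip: N_def)
  have "incidences m' = insert (z, j) (incidences m)"
    unfolding m'_def by (rule incidences_insert) (simp add: N_def)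
  then have "read_state j (ys @ [z]) m' (tl inp) out"
    using *(3,4) zs by (auto simp: read_state_def m'_def N_def)
  moreover have "m' (cell 0 cnt) = length zs'" using *(2) zs by (simp add: m'_def)
  ultimately have "elem_state j m' (tl inp) out"
    unfolding elem_state_def using *(1,3) zs by (intro exI[of _ "ys @ [z]"] exI[of _ zs']) auto
  moreover have "m' (cell 0 cnt) < c" using A by (simp add: m'_def)
  ultimately show "wp read_elem (\<lambda>m inp out. elem_state j m inp out \<and> m (cell 0 cnt) < c) m inp out"
    unfolding wp by blast
qed (simp add: read_elem_def)

lemma read_edge_correct:
  assumes j: "j < length es"
  shows "triple (\<lambda>m inp out. read_state j [] m inp out \<and> inp = rest j)
     read_edge (1 + (S * (4 + 1) + 1 + 3))
     (\<lambda>m inp out. read_state (Suc j) [] m inp out \<and> inp = rest (Suc j))"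
proof -
  have 1: "triple (\<lambda>m inp out. read_state j [] m inp out \<and> inp = rest j) (read_var cnt) 1
      (\<lambda>m inp out. elem_state j m inp out \<and> m (cell 0 cnt) \<le> S)"
  proof (rule triple_wp)
    fix m inp out
    assume A: "read_state j [] m inp out \<and> inp = rest j"
    let ?m = "m(cell 0 cnt := length (es ! j))"
    have inp: "inp = length (es ! j) # es ! j @ [h1 (set (es ! j)), h2 (set (es ! j))] @ rest (Suc j)"
      using A rest_step[OF j] by (simp add: encode_edge_def)
    have st: "read_state j [] m inp out" using A by blast
    have "incidences ?m = incidences m" by (rule incidences_cong) auto
    then have "read_state j [] ?m (tl inp) out"
      using st inp by (auto simp: read_state_def)
    then have "elem_state j ?m (tl inp) out"
      unfolding elem_state_def using inp by (intro exI[of _ "[]"] exI[of _ "es ! j"]) auto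
    moreover have "length (es ! j) \<le> S" using st inp by (auto simp: read_state_def)
    ultimately show "wp (read_var cnt) (\<lambda>m inp out. elem_state j m inp out \<and> m (cell 0 cnt) \<le> S) m inp out"
      using inp by simp
  qed simp
  have 2: "triple (\<lambda>m inp out. elem_state j m inp out \<and> m (cell 0 cnt) \<le> S)
      (While (var cnt) read_elem) (S * (4 + 1) + 1)
      (\<lambda>m inp out. elem_state j m inp out \<and> m (cell 0 cnt) = 0)"
    by (rule triple_While[OF read_elem_correct]) auto
  have 3: "triple (\<lambda>m inp out. elem_state j m inp out \<and> m (cell 0 cnt) = 0)
      (Read (addr head1_arr (var idx)) ;; Read (addr head2_arr (var idx)) ;; incr idx) 3
      (\<lambda>m inp out. read_state (Suc j) [] m inp out \<and> inp = rest (Suc j))"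
  proof (rule triple_wp)
    fix m inp out
    assume A: "elem_state j m inp out \<and> m (cell 0 cnt) = 0"
    then have inp: "inp = [h1 (set (es ! j)), h2 (set (es ! j))] @ rest (Suc j)"
      and st: "read_state j (es ! j) m inp out"
      by (auto simp: elem_state_def)
    let ?m = "m(cell head1_arr j := h1 (set (es ! j)), cell head2_arr j := h2 (set (es ! j)),
      cell 0 idx := Suc j)"
    have "incidences ?m = incidences m" by (rule incidences_cong) auto
    then have "read_state (Suc j) [] ?m (rest (Suc j)) out"
      using st inp by (auto simp: read_state_def less_Suc_eq)
    moreover have "m (cell 0 idx) = j" using st by (simp add: read_state_def)
    ultimately show "wp (Read (addr head1_arr (var idx)) ;; Read (addr head2_arr (var idx)) ;; incr idx)
      (\<lambda>m inp out. read_state (Suc j) [] m inp out \<and> inp = rest (Suc j)) m inp out"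
      using inp by simp
  qed simp
  from triple_Seq[OF 1 triple_Seq[OF 2 3]] show ?thesis by (simp add: read_edge_def)
qed

lemma read_edges_correct:
  assumes "length es \<le> S"
  shows "triple (\<lambda>m inp out. blank m \<and>
       inp = length es # rest 0 \<and> length inp \<le> S \<and> out = [])
     read_edges (2 + (S * (1 + (S * (4 + 1) + 1 + 3) + 1) + 1))
     (\<lambda>m inp out. loaded es h1 h2 S m \<and> (\<forall>x. m (cell rank1_arr x) = 0) \<and>
       (\<forall>x. m (cell rank2_arr x) = 0) \<and> out = [])"
proof -
  let ?I = "\<lambda>m inp out. \<exists>j\<le>length es. read_state j [] m inp out \<and> inp = rest j"
  have 1: "triple (\<lambda>m inp out. blank m \<and>
       inp = length es # rest 0 \<and> length inp \<le> S \<and> out = [])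
      (set_var idx (Const 0) ;; read_var n_edge) 2 ?I"
    by (rule triple_wp) (auto simp: read_state_def incidences_def blank_def)
  have 2: "triple ?I (While (Sub (var n_edge) (var idx)) read_edge)
     (S * (1 + (S * (4 + 1) + 1 + 3) + 1) + 1)
     (\<lambda>m inp out. loaded es h1 h2 S m \<and> (\<forall>x. m (cell rank1_arr x) = 0) \<and>
       (\<forall>x. m (cell rank2_arr x) = 0) \<and> out = [])"
  proof (rule triple_While[where \<mu> = "\<lambda>m. length es - m (cell 0 idx)" and I = ?I])
    fix k
    \<comment> \<open>The number \<open>j\<close> of edges read is first a constant;
      \<open>triple_ex\<close> then restores the existential quantifier of the invariant.\<close>
    have "triple (\<lambda>m inp out. j < length es \<and> k = length es - j \<and> read_state j [] m inp out \<and> inp = rest j)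
       read_edge (1 + (S * (4 + 1) + 1 + 3))
       (\<lambda>m inp out. ?I m inp out \<and> length es - m (cell 0 idx) < k)" for j
    proof (cases "j < length es \<and> k = length es - j")
      case True
      show ?thesis
      proof (rule triple_conseq[OF read_edge_correct[of j]])
        fix m inp out
        assume A: "read_state (Suc j) [] m inp out \<and> inp = rest (Suc j)"
        then have "m (cell 0 idx) = Suc j" by (simp add: read_state_def)
        with A True show "?I m inp out \<and> length es - m (cell 0 idx) < k"
          by (intro conjI exI[of _ "Suc j"]) auto
      qed (use True in auto)
    qed (auto simp: triple_def)
    note * = triple_ex[OF this]
    show "triple (\<lambda>m inp out. ?I m inp out \<and> expr_val (Sub (var n_edge) (var idx)) m \<noteq> 0 \<and>
        length es - m (cell 0 idx) = k)
       read_edge (1 + (S * (4 + 1) + 1 + 3))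
       (\<lambda>m inp out. ?I m inp out \<and> length es - m (cell 0 idx) < k)"
    proof (rule triple_conseq[OF *])
      fix m inp out
      assume "?I m inp out \<and> expr_val (Sub (var n_edge) (var idx)) m \<noteq> 0 \<and>
        length es - m (cell 0 idx) = k"
      then show "\<exists>j. j < length es \<and> k = length es - j \<and> read_state j [] m inp out \<and> inp = rest j"
        by (auto simp: read_state_def)
    qed auto
  next
    fix m inp out
    assume "?I m inp out" "expr_val (Sub (var n_edge) (var idx)) m = 0"
    then have "read_state (length es) [] m inp out" by (auto simp: read_state_def)
    then show "loaded es h1 h2 S m \<and> (\<forall>x. m (cell rank1_arr x) = 0) \<and>
       (\<forall>x. m (cell rank2_arr x) = 0) \<and> out = []"
      by (auto simp: read_state_def loaded_def incidences_def)
  next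
    fix m :: memory and inp out
    assume "?I m inp out"
    moreover have "length es - m (cell 0 idx) \<le> S" using assms by simp
    ultimately show "?I m inp out \<and> length es - m (cell 0 idx) \<le> S" by blast
  qed
  from triple_Seq[OF 1 2] show ?thesis by (simp add: read_edges_def)
qed

end

lemma skip_vertices_correct:
  assumes "length vs \<le> S"
  shows "triple (\<lambda>m inp out. m = (\<lambda>_. 0) \<and> inp = length vs # vs @ inp' \<and> out = [])
     skip_vertices (1 + (S * (2 + 1) + 1)) (\<lambda>m inp out. blank m \<and> inp = inp' \<and> out = [])"
proof -
  let ?I = "\<lambda>m inp out. blank m \<and> (\<exists>us. inp = us @ inp' \<and> length us = m (cell 0 cnt)) \<and> out = []"
  have 1: "triple (\<lambda>m inp out. m = (\<lambda>_. 0) \<and> inp = length vs # vs @ inp' \<and> out = []) (read_var cnt) 1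
      (\<lambda>m inp out. ?I m inp out \<and> m (cell 0 cnt) \<le> S)"
  proof (rule triple_wp)
    fix m :: memory and inp out :: "nat list"
    assume "m = (\<lambda>_. 0) \<and> inp = length vs # vs @ inp' \<and> out = []"
    moreover from this have "blank m" by (simp add: blank_def)
    ultimately show "wp (read_var cnt) (\<lambda>m inp out. ?I m inp out \<and> m (cell 0 cnt) \<le> S) m inp out"
      using assms by simp
  qed simp
  have 2: "triple (\<lambda>m inp out. ?I m inp out \<and> m (cell 0 cnt) \<le> S)
      (While (var cnt) (read_var idx ;; decr cnt)) (S * (2 + 1) + 1)
      (\<lambda>m inp out. blank m \<and> inp = inp' \<and> out = [])"
  proof (rule triple_While[where \<mu> = "\<lambda>m. m (cell 0 cnt)" and I = ?I])
    show "triple (\<lambda>m inp out. ?I m inp out \<and> expr_val (var cnt) m \<noteq> 0 \<and> m (cell 0 cnt) = k)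
      (read_var idx ;; decr cnt) 2 (\<lambda>m inp out. ?I m inp out \<and> m (cell 0 cnt) < k)" for k
    proof (rule triple_wp)
      fix m :: memory and inp out :: "nat list"
      assume A: "?I m inp out \<and> expr_val (var cnt) m \<noteq> 0 \<and> m (cell 0 cnt) = k"
      then have m: "blank m" "out = []" "m (cell 0 cnt) = k" "k \<noteq> 0" by simp_all
      from A obtain us where us: "inp = us @ inp'" "length us = k" by blast
      then obtain u us' where "us = u # us'" using m(4) by (cases us) simp_all
      then have "inp = u # us' @ inp'" "length us' = k - 1" using us by simp_all
      then show "wp (read_var idx ;; decr cnt) (\<lambda>m inp out. ?I m inp out \<and> m (cell 0 cnt) < k) m inp out"
        using m by simp
    qed simp
  next
    fix m :: memory and inp out :: "nat list"
    assume "?I m inp out" "expr_val (var cnt) m = 0"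
    then show "blank m \<and> inp = inp' \<and> out = []" by simp
  qed
  from triple_Seq[OF 1 2] show ?thesis by (simp add: skip_vertices_def)
qed


section \<open>Computing ranks\<close>

text \<open>Covers both rank computations. Array \<open>r\<close> is being filled, while
  \<open>r'\<close> must keep its content \<open>z\<close>; \<open>d\<close> is a rank function
  known to exist, which appears in the analysis only.\<close>

locale rank_computation =
  fixes es :: "nat list list" and h1 h2 h :: "nat set \<Rightarrow> nat" and S ha r r' :: nat
    and d z :: "nat \<Rightarrow> nat"
  assumes head: "ha = head1_arr \<and> h = h1 \<or> ha = head2_arr \<and> h = h2"
    and rank_arrs: "{r, r'} = {rank1_arr, rank2_arr}"
    and ranks: "ranks (set ` set es) h d" and bound: "\<And>v. d v \<le> S" and size: "length es \<le> S"
begin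

lemma arrs [simp]: "r < 8" "r' < 8" "r \<noteq> 0" "r \<noteq> Suc 0" "r \<noteq> 2" "r \<noteq> 3" "r \<noteq> 4" "r' \<noteq> 0"
   "r \<noteq> r'" "5 \<le> r" "ha < 8" "ha \<noteq> 0" "ha \<noteq> r" "r' \<noteq> r" "ha \<noteq> 1" "ha \<noteq> 2"
  using rank_arrs head by (auto simp: doubleton_eq_iff)

definition hd_of :: "nat \<Rightarrow> nat" where
  "hd_of k = h (set (es ! k))"

lemma loaded_head: "loaded es h1 h2 S m \<Longrightarrow> k < length es \<Longrightarrow> m (cell ha k) = hd_of k"
  using head by (auto simp: loaded_def hd_of_def)

definition rank_state :: "memory \<Rightarrow> nat list \<Rightarrow> bool" where
  "rank_state m out \<longleftrightarrow> loaded es h1 h2 S m \<and> (\<forall>x. m (cell r' x) = z x) \<and>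
     (\<forall>v. m (cell r v) \<le> d v) \<and> out = []"

text \<open>\<open>r0\<close> holds the ranks before the pass. Without a change, all arcs seen so
  far increase \<open>r0\<close>; after a change, the rank of some head has grown.\<close>

definition pass_state :: "(nat \<Rightarrow> nat) \<Rightarrow> memory \<Rightarrow> nat list \<Rightarrow> bool" where
  "pass_state r0 m out \<longleftrightarrow> rank_state m out \<and> (\<forall>v. r0 v \<le> m (cell r v)) \<and>
     m (cell 0 idx) \<le> m (cell 0 n_inc) \<and>
     (if m (cell 0 changed) = 0
      then (\<forall>v. m (cell r v) = r0 v) \<and>
        (\<forall>i<m (cell 0 idx). m (cell vert_arr i) \<noteq> hd_of (m (cell edge_arr i)) \<longrightarrow>
           r0 (m (cell vert_arr i)) < r0 (hd_of (m (cell edge_arr i))))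
      else \<exists>k<length es. r0 (hd_of k) < m (cell r (hd_of k)))"

lemma relax_correct:
  "triple (\<lambda>m inp out. pass_state r0 m out \<and> expr_val (Sub (var n_inc) (var idx)) m \<noteq> 0 \<and>
       m (cell 0 n_inc) - m (cell 0 idx) = k) (relax ha r) 7
     (\<lambda>m inp out. pass_state r0 m out \<and> m (cell 0 n_inc) - m (cell 0 idx) < k)"
proof (rule triple_wp)
  fix m :: memory and inp out
  assume A: "pass_state r0 m out \<and> expr_val (Sub (var n_inc) (var idx)) m \<noteq> 0 \<and>
       m (cell 0 n_inc) - m (cell 0 idx) = k"
  define i where "i = m (cell 0 idx)"
  define x where "x = m (cell vert_arr i)"
  define e where "e = m (cell edge_arr i)"
  define y where "y = hd_of e"
  have load: "loaded es h1 h2 S m" and i: "i < m (cell 0 n_inc)"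
    and rs: "rank_state m out" and r0: "\<And>v. r0 v \<le> m (cell r v)"
    using A by (auto simp: pass_state_def rank_state_def i_def)
  have e: "e < length es" "x \<in> set (es ! e)"
    using loaded_incidence[OF load i] by (auto simp: e_def x_def)
  have y: "m (cell ha e) = y" using loaded_head[OF load e(1)] by (simp add: y_def)
  have d: "d x < d y" if "x \<noteq> y"
    using ranks e that by (auto simp: ranks_def y_def hd_of_def)
  have vals: "m (cell 0 idx) = i" "m (cell (Suc 0) i) = x" "m (cell edge_arr i) = e"
    by (simp_all add: i_def x_def e_def)
  have relax: "wp (relax ha r) Q m inp out \<longleftrightarrow>
      (if x \<noteq> y \<and> m (cell r y) \<le> m (cell r x)
       then Q (m(cell r y := Suc (m (cell r x)), cell 0 changed := 1, cell 0 idx := Suc i)) inp out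
       else Q (m(cell 0 idx := Suc i)) inp out)" for Q
    using y by (auto simp: relax_def Let_def vals)
  show "wp (relax ha r)
      (\<lambda>m inp out. pass_state r0 m out \<and> m (cell 0 n_inc) - m (cell 0 idx) < k) m inp out"
  proof (cases "x \<noteq> y \<and> m (cell r y) \<le> m (cell r x)")
    case True
    have le: "m (cell r v) \<le> d v" for v using rs by (simp add: rank_state_def)
    \<comment> \<open>Relaxation cannot exceed \<open>d\<close>: the rank of \<open>x\<close> is at
      most \<open>d x\<close>, and \<open>d x < d y\<close> along the arc.\<close>
    have "Suc (m (cell r x)) \<le> d y" using d True le[of x] by simp
    moreover have "r0 y \<le> m (cell r x)" using r0[of y] True by simp
    ultimately have "pass_state r0
        (m(cell r y := Suc (m (cell r x)), cell 0 changed := 1, cell 0 idx := Suc i)) out"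
      using rs r0 e(1) i True unfolding pass_state_def rank_state_def
      by (auto simp: y_def intro!: exI[of _ e])
    moreover have "m (cell 0 n_inc) - Suc i < k" using A i by (auto simp: i_def)
    ultimately show ?thesis unfolding relax using True by simp
  next
    case False
    have "pass_state r0 (m(cell 0 idx := Suc i)) out"
      using A i False unfolding pass_state_def rank_state_def
      by (auto simp: less_Suc_eq vals simp flip: y_def)
    moreover have "m (cell 0 n_inc) - Suc i < k" using A i by (auto simp: i_def)
    ultimately show ?thesis unfolding relax using False by auto
  qed
qed (simp add: relax_def Let_def)

text \<open>Only ranks of heads ever rise, so summing over edges suffices. The flag contributes 1 so
  that the final pass, which raises nothing, decreases the measure too.\<close>

definition progress :: "memory \<Rightarrow> nat" where
  "progress m = (if m (cell 0 changed) = 0 then 0 else 1) +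
     (S * S - (\<Sum>k<length es. m (cell r (hd_of k))))"

lemma sum_ranks_le: "rank_state m out \<Longrightarrow> (\<Sum>k<length es. m (cell r (hd_of k))) \<le> S * S"
proof -
  assume "rank_state m out"
  then have "(\<Sum>k<length es. m (cell r (hd_of k))) \<le> (\<Sum>k<length es. S)"
    using bound by (intro sum_mono) (auto simp: rank_state_def intro: order_trans)
  also have "\<dots> \<le> S * S" using size by simp
  finally show ?thesis .
qed

definition pass_end :: "memory \<Rightarrow> nat list \<Rightarrow> bool" where
  "pass_end m out \<longleftrightarrow> rank_state m out \<and>
     (m (cell 0 changed) = 0 \<longrightarrow> ranks (set ` set es) h (\<lambda>v. m (cell r v)))"

lemma rank_pass_correct:
  "triple (\<lambda>m inp out. pass_end m out \<and> expr_val (var changed) m \<noteq> 0 \<and> progress m = k)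
     (rank_pass ha r) (2 + (S * 8 + 1)) (\<lambda>m inp out. pass_end m out \<and> progress m < k)"
\<comment> \<open>The loop invariant compares the current ranks with those before the pass, hence
  the fixed \<open>m0\<close>.\<close>
proof (rule triple_fix[where P' = "\<lambda>m. rank_state m [] \<and> m (cell 0 changed) \<noteq> 0 \<and> progress m = k"])
  fix m0
  assume m0: "rank_state m0 [] \<and> m0 (cell 0 changed) \<noteq> 0 \<and> progress m0 = k"
  define r0 where "r0 = (\<lambda>v. m0 (cell r v))"
  have 1: "triple (\<lambda>m inp out. (pass_end m out \<and> expr_val (var changed) m \<noteq> 0 \<and> progress m = k) \<and>
      m = m0) (set_var changed (Const 0) ;; set_var idx (Const 0)) 2
      (\<lambda>m inp out. pass_state r0 m out \<and> m (cell 0 n_inc) \<le> S)"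
    by (rule triple_wp)
      (auto simp: pass_end_def pass_state_def rank_state_def r0_def, auto simp: loaded_def)
  have 2: "triple (\<lambda>m inp out. pass_state r0 m out \<and> m (cell 0 n_inc) \<le> S)
      (While (Sub (var n_inc) (var idx)) (relax ha r)) (S * (7 + 1) + 1)
      (\<lambda>m inp out. pass_end m out \<and> progress m < k)"
  proof (rule triple_While[OF relax_correct])
    fix m inp out
    assume P: "pass_state r0 m out" and "expr_val (Sub (var n_inc) (var idx)) m = 0"
    then have idx: "m (cell 0 idx) = m (cell 0 n_inc)" by (simp add: pass_state_def)
    have rs: "rank_state m out" and load: "loaded es h1 h2 S m"
      using P by (auto simp: pass_state_def rank_state_def)
    show "pass_end m out \<and> progress m < k"
    proof (cases "m (cell 0 changed) = 0")
      case True
      then have eq: "m (cell r v) = r0 v" for v using P by (simp add: pass_state_def)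
      have "ranks (set ` set es) h r0"
        unfolding ranks_def
      proof clarify
        fix xs x
        assume "xs \<in> set es" "x \<in> set xs" and neq: "x \<noteq> h (set xs)"
        then obtain k where k: "k < length es" "xs = es ! k" by (auto simp: in_set_conv_nth)
        then have "(x, k) \<in> (\<lambda>i. (m (cell vert_arr i), m (cell edge_arr i))) ` {..<m (cell 0 n_inc)}"
          using load \<open>x \<in> set xs\<close> by (simp add: loaded_def)
        then obtain i where "i < m (cell 0 n_inc)" "x = m (cell vert_arr i)" "k = m (cell edge_arr i)"
          by auto
        then show "r0 x < r0 (h (set xs))"
          using P True neq idx k by (auto simp: pass_state_def hd_of_def)
      qed
      then show ?thesis using True rs m0 eq by (auto simp: pass_end_def progress_def r0_def)
    next
      case False
      obtain k' where k': "k' < length es" "r0 (hd_of k') < m (cell r (hd_of k'))"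
        using P False by (auto simp: pass_state_def)
      \<comment> \<open>No rank falls and that of one head rises; the bound \<open>S * S\<close> on
        the new sum keeps the truncated difference strictly decreasing.\<close>
      have "(\<Sum>k<length es. r0 (hd_of k)) < (\<Sum>k<length es. m (cell r (hd_of k)))"
        using P k' by (intro sum_strict_mono_ex1) (auto simp: pass_state_def)
      then show ?thesis
        using False rs m0 sum_ranks_le[OF rs] by (auto simp: pass_end_def progress_def r0_def)
    qed
  qed auto
  from triple_Seq[OF 1 2] show "triple (\<lambda>m inp out. (pass_end m out \<and> expr_val (var changed) m \<noteq> 0 \<and>
      progress m = k) \<and> m = m0) (rank_pass ha r) (2 + (S * 8 + 1))
      (\<lambda>m inp out. pass_end m out \<and> progress m < k)"
    by (simp add: rank_pass_def)
qed (auto simp: pass_end_def rank_state_def)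

lemma compute_ranks_correct:
  "triple (\<lambda>m inp out. loaded es h1 h2 S m \<and> (\<forall>x. m (cell r x) = 0) \<and> (\<forall>x. m (cell r' x) = z x) \<and>
       out = [])
     (compute_ranks ha r) (1 + ((S * S + 1) * (2 + (S * 8 + 1) + 1) + 1))
     (\<lambda>m inp out. loaded es h1 h2 S m \<and> ranks (set ` set es) h (\<lambda>v. m (cell r v)) \<and>
       (\<forall>x. m (cell r' x) = z x) \<and> out = [])"
proof -
  have 1: "triple (\<lambda>m inp out. loaded es h1 h2 S m \<and> (\<forall>x. m (cell r x) = 0) \<and>
       (\<forall>x. m (cell r' x) = z x) \<and> out = []) (set_var changed (Const 1)) 1
      (\<lambda>m inp out. pass_end m out)"
    by (rule triple_wp) (auto simp: pass_end_def rank_state_def)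
  have 2: "triple (\<lambda>m inp out. pass_end m out) (While (var changed) (rank_pass ha r))
     ((S * S + 1) * (2 + (S * 8 + 1) + 1) + 1)
     (\<lambda>m inp out. loaded es h1 h2 S m \<and> ranks (set ` set es) h (\<lambda>v. m (cell r v)) \<and>
       (\<forall>x. m (cell r' x) = z x) \<and> out = [])"
    by (rule triple_While[OF rank_pass_correct])
      (auto simp: progress_def pass_end_def rank_state_def)
  from triple_Seq[OF 1 2] show ?thesis by (simp add: compute_ranks_def)
qed

end


section \<open>Sorting the pairs of heads\<close>

text \<open>With \<open>a\<close> the current array of first heads, these are the pairs still to be
  emitted: retired edges have equal heads and drop out.\<close>

definition active :: "nat \<Rightarrow> (nat \<Rightarrow> nat) \<Rightarrow> (nat \<Rightarrow> nat) \<Rightarrow> (nat \<times> nat) set" where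
  "active n a b = {(a k, b k) |k. k < n \<and> a k \<noteq> b k}"

definition sort_state ::
  "nat \<Rightarrow> (nat \<Rightarrow> nat) \<Rightarrow> (nat \<Rightarrow> nat) \<Rightarrow> (nat \<Rightarrow> nat) \<Rightarrow> (nat \<Rightarrow> nat) \<Rightarrow> memory \<Rightarrow> bool" where
  "sort_state n f g a b m \<longleftrightarrow> m (cell 0 n_edge) = n \<and>
     (\<forall>k<n. m (cell head1_arr k) = a k \<and> m (cell head2_arr k) = b k) \<and>
     (\<forall>x. m (cell rank1_arr x) = f x \<and> m (cell rank2_arr x) = g x)"

text \<open>Equal components encode that there is no pair.\<close>

definition first_of ::
  "(nat \<Rightarrow> nat) \<Rightarrow> (nat \<Rightarrow> nat) \<Rightarrow> (nat \<times> nat) set \<Rightarrow> nat \<times> nat \<Rightarrow> bool" where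
  "first_of f g A p \<longleftrightarrow> (if fst p = snd p then A = {} else p \<in> A \<and> (\<forall>q\<in>A. flip_before f g p q))"

lemma active_Suc:
  "active (Suc n) a b = (if a n = b n then active n a b else insert (a n, b n) (active n a b))"
  by (auto simp: active_def less_Suc_eq)

lemma active_cong:
  "(\<And>k. k < n \<Longrightarrow> a k = a' k \<and> b k = b' k) \<Longrightarrow> active n a b = active n a' b'"
  unfolding active_def by (intro Collect_cong) force

lemma finite_active: "finite (active n a b)" and card_active: "card (active n a b) \<le> n"
proof -
  have "active n a b \<subseteq> (\<lambda>k. (a k, b k)) ` {..<n}" by (auto simp: active_def)
  then show "finite (active n a b)" "card (active n a b) \<le> n"
    using finite_subset surj_card_le[of "{..<n}"] by auto
qed

lemma flip_before_refl: "flip_before f g p p"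
  by (auto simp: flip_before_def)

lemma flip_before_trans: "flip_before f g p q \<Longrightarrow> flip_before f g q r \<Longrightarrow> flip_before f g p r"
  by (auto simp: flip_before_def)

lemma first_of_insert:
  assumes "first_of f g A p" "fst q \<noteq> snd q" "fst p = snd p \<or> flip_before f g q p"
  shows "first_of f g (insert q A) q"
proof (cases "fst p = snd p")
  case False
  then have "flip_before f g q p" "\<And>r. r \<in> A \<Longrightarrow> flip_before f g p r"
    using assms by (auto simp: first_of_def)
  then have "flip_before f g q r" if "r \<in> A" for r
    using flip_before_trans that by blast
  then show ?thesis using assms(2) by (simp add: first_of_def flip_before_refl)
qed (use assms in \<open>auto simp: first_of_def flip_before_refl\<close>)

lemma first_of_insert_later:
  assumes "first_of f g A p" "fst p \<noteq> snd p" "flip_before f g p q"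
  shows "first_of f g (insert q A) p"
  using assms by (auto simp: first_of_def)

lemma improve_correct:
  "triple (\<lambda>m inp out. (sort_state n f g a b m \<and> out = w \<and> m (cell 0 idx) \<le> n \<and>
        first_of f g (active (m (cell 0 idx)) a b) (m (cell 0 best_u), m (cell 0 best_v))) \<and>
        expr_val (Sub (var n_edge) (var idx)) m \<noteq> 0 \<and> n - m (cell 0 idx) = k)
     improve 20
     (\<lambda>m inp out. (sort_state n f g a b m \<and> out = w \<and> m (cell 0 idx) \<le> n \<and>
        first_of f g (active (m (cell 0 idx)) a b) (m (cell 0 best_u), m (cell 0 best_v))) \<and>
        n - m (cell 0 idx) < k)"
proof (rule triple_wp)
  fix m :: memory and inp out
  assume A: "(sort_state n f g a b m \<and> out = w \<and> m (cell 0 idx) \<le> n \<and>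
        first_of f g (active (m (cell 0 idx)) a b) (m (cell 0 best_u), m (cell 0 best_v))) \<and>
        expr_val (Sub (var n_edge) (var idx)) m \<noteq> 0 \<and> n - m (cell 0 idx) = k"
  define j where "j = m (cell 0 idx)"
  define u' where "u' = m (cell 0 best_u)"
  define v' where "v' = m (cell 0 best_v)"
  have j: "j < n" "m (cell head1_arr j) = a j" "m (cell head2_arr j) = b j"
    and rk: "m (cell rank1_arr x) = f x" "m (cell rank2_arr x) = g x" for x
    using A by (auto simp: sort_state_def j_def)
  have st: "sort_state n f g a b (m(cell 0 best_u := x, cell 0 best_v := y, cell 0 idx := z))"
    "sort_state n f g a b (m(cell 0 idx := z))" for x y z
    using A by (auto simp: sort_state_def)
  have first: "first_of f g (active j a b) (u', v')"
    using A by (simp add: j_def u'_def v'_def)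
  \<comment> \<open>Every branch of \<open>improve\<close> keeps or replaces the candidate;
    \<open>skip\<close> and \<open>take\<close> say when either is right.\<close>
  have skip: "first_of f g (active (Suc j) a b) (u', v')" if "a j = b j \<or>
      u' \<noteq> v' \<and> flip_before f g (u', v') (a j, b j)"
    using that first first_of_insert_later[OF first] by (auto simp: active_Suc)
  have take: "first_of f g (active (Suc j) a b) (a j, b j)" if "a j \<noteq> b j"
      "u' = v' \<or> flip_before f g (a j, b j) (u', v')"
    using that first_of_insert[OF first, of "(a j, b j)"] by (auto simp: active_Suc)
  show "wp improve (\<lambda>m inp out. (sort_state n f g a b m \<and> out = w \<and> m (cell 0 idx) \<le> n \<and>
        first_of f g (active (m (cell 0 idx)) a b) (m (cell 0 best_u), m (cell 0 best_v))) \<and>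
        n - m (cell 0 idx) < k) m inp out"
    using A j st skip take
    unfolding improve_def Let_def
    by (auto simp: rk flip_before_def simp flip: j_def u'_def v'_def)
qed (simp add: improve_def Let_def)

lemma select_best_correct:
  assumes "n \<le> S"
  shows "triple (\<lambda>m inp out. sort_state n f g a b m \<and> out = w) select_best (3 + (S * 21 + 1))
     (\<lambda>m inp out. sort_state n f g a b m \<and> out = w \<and>
        first_of f g (active n a b) (m (cell 0 best_u), m (cell 0 best_v)))"
proof -
  let ?I = "\<lambda>m inp out. sort_state n f g a b m \<and> out = w \<and> m (cell 0 idx) \<le> n \<and>
        first_of f g (active (m (cell 0 idx)) a b) (m (cell 0 best_u), m (cell 0 best_v))"
  have 1: "triple (\<lambda>m inp out. sort_state n f g a b m \<and> out = w)
      (set_var best_u (Const 0) ;; set_var best_v (Const 0) ;; set_var idx (Const 0)) 3 ?I"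
    by (rule triple_wp) (auto simp: sort_state_def first_of_def active_def)
  have 2: "triple ?I (While (Sub (var n_edge) (var idx)) improve) (S * (20 + 1) + 1)
     (\<lambda>m inp out. sort_state n f g a b m \<and> out = w \<and>
        first_of f g (active n a b) (m (cell 0 best_u), m (cell 0 best_v)))"
  proof (rule triple_While[where \<mu> = "\<lambda>m. n - m (cell 0 idx)", OF improve_correct])
    fix m inp out
    assume I: "?I m inp out" and z: "expr_val (Sub (var n_edge) (var idx)) m = 0"
    then have "m (cell 0 idx) = n" by (simp add: sort_state_def)
    then show "sort_state n f g a b m \<and> out = w \<and>
        first_of f g (active n a b) (m (cell 0 best_u), m (cell 0 best_v))"
      using I by simp
  qed (use assms in auto)
  from triple_Seq[OF 1 2] show ?thesis by (simp add: select_best_def)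
qed

lemma active_retire:
  assumes "u \<noteq> v"
  shows "active n (\<lambda>k. if a k = u \<and> b k = v then v else a k) b = active n a b - {(u, v)}"
  using assms by (auto simp: active_def)

lemma emit_correct:
  assumes "n \<le> S"
  shows "triple (\<lambda>m inp out. sort_state n f g a b m \<and> out = w \<and>
        m (cell 0 best_u) = u \<and> m (cell 0 best_v) = v) emit (3 + (S * 5 + 1))
     (\<lambda>m inp out. sort_state n f g (\<lambda>k. if a k = u \<and> b k = v then v else a k) b m \<and>
        out = w @ [u, v])"
proof -
  define a' where "a' = (\<lambda>k. if a k = u \<and> b k = v then v else a k)"
  \<comment> \<open>Positions below \<open>idx\<close> already carry the new first heads.\<close>
  let ?a = "\<lambda>j k. if k < j then a' k else a k"
  let ?I = "\<lambda>m inp out. sort_state n f g (?a (m (cell 0 idx))) b m \<and> out = w @ [u, v] \<and>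
        m (cell 0 idx) \<le> n \<and> m (cell 0 best_u) = u \<and> m (cell 0 best_v) = v"
  have 1: "triple (\<lambda>m inp out. sort_state n f g a b m \<and> out = w \<and>
        m (cell 0 best_u) = u \<and> m (cell 0 best_v) = v)
      (Write (var best_u) ;; Write (var best_v) ;; set_var idx (Const 0)) 3 ?I"
    by (rule triple_wp) (auto simp: sort_state_def)
  have 2: "triple ?I (While (Sub (var n_edge) (var idx)) retire) (S * (4 + 1) + 1)
     (\<lambda>m inp out. sort_state n f g a' b m \<and> out = w @ [u, v])"
  proof (rule triple_While[where \<mu> = "\<lambda>m. n - m (cell 0 idx)" and I = ?I])
    show "triple (\<lambda>m inp out. ?I m inp out \<and> expr_val (Sub (var n_edge) (var idx)) m \<noteq> 0 \<and>
        n - m (cell 0 idx) = k) retire 4 (\<lambda>m inp out. ?I m inp out \<and> n - m (cell 0 idx) < k)" for k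
      by (rule triple_wp)
        (auto simp: retire_def Let_def sort_state_def neq_def less_Suc_eq a'_def)
  next
    fix m inp out
    assume I: "?I m inp out" and z: "expr_val (Sub (var n_edge) (var idx)) m = 0"
    then have "m (cell 0 idx) = n" by (simp add: sort_state_def)
    then show "sort_state n f g a' b m \<and> out = w @ [u, v]"
      using I by (auto simp: sort_state_def)
  qed (use assms in auto)
  from triple_Seq[OF 1 2] show ?thesis by (simp add: emit_def a'_def)
qed

lemma encode_pairs_snoc: "encode_pairs (ps @ [(u, v)]) = encode_pairs ps @ [u, v]"
  by (simp add: encode_pairs_def)

lemma sort_pairs_correct:
  assumes "n \<le> S"
  shows "triple (\<lambda>m inp out. sort_state n f g a b m \<and> out = []) sort_pairs
     ((3 + (S * 21 + 1)) + (S * ((3 + (S * 5 + 1)) + (3 + (S * 21 + 1)) + 1) + 1))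
     (\<lambda>m inp out. \<exists>ps. out = encode_pairs ps \<and> distinct ps \<and> set ps = active n a b \<and>
        sorted_wrt (flip_before f g) ps)"
proof -
  define J where "J = (\<lambda>a' ps (m :: memory) (inp :: nat list) out.
     sort_state n f g a' b m \<and> out = encode_pairs ps \<and> distinct ps \<and>
     set ps \<union> active n a' b = active n a b \<and> set ps \<inter> active n a' b = {} \<and>
     sorted_wrt (flip_before f g) ps \<and> (\<forall>p\<in>set ps. \<forall>q\<in>active n a' b. flip_before f g p q))"
  define F where "F = (\<lambda>a' (m :: memory).
     first_of f g (active n a' b) (m (cell 0 best_u), m (cell 0 best_v)))"
  let ?I = "\<lambda>m inp out. \<exists>a' ps. J a' ps m inp out \<and> F a' m"
  \<comment> \<open>The measure has to be a function of the memory, so the heads are read off the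
    arrays.\<close>
  let ?c = "\<lambda>m. card (active n (\<lambda>k. m (cell head1_arr k)) (\<lambda>k. m (cell head2_arr k)))"
  have card: "?c m = card (active n a' b)" if "sort_state n f g a' b m" for a' m
    using that active_cong[of n "\<lambda>k. m (cell head1_arr k)" a' "\<lambda>k. m (cell head2_arr k)" b]
    by (auto simp: sort_state_def)
  have select: "triple (J a' ps) select_best (3 + (S * 21 + 1))
      (\<lambda>m inp out. J a' ps m inp out \<and> F a' m)" for a' ps
  \<comment> \<open>If any state satisfies \<open>J a' ps\<close>, its conjuncts about
    \<open>ps\<close> alone hold outright and can be carried across the triple; otherwise the triple
    is vacuous.\<close>
  proof (cases "\<exists>m inp out. J a' ps m inp out")
    case True
    show ?thesis
      by (rule triple_conseq[OF select_best_correct[OF assms, of f g a' b "encode_pairs ps"]])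
        (use True in \<open>auto simp: J_def F_def\<close>)
  qed (auto simp: triple_def)
  have 1: "triple (\<lambda>m inp out. sort_state n f g a b m \<and> out = []) select_best (3 + (S * 21 + 1)) ?I"
  proof (rule triple_conseq[OF select[of a "[]"]])
    show "J a [] m inp out" if "sort_state n f g a b m \<and> out = []" for m inp out
      using that by (simp add: J_def encode_pairs_def)
  qed blast+
  have 2: "triple ?I (While (neq (var best_u) (var best_v)) (emit ;; select_best))
     (S * (((3 + (S * 5 + 1)) + (3 + (S * 21 + 1))) + 1) + 1)
     (\<lambda>m inp out. \<exists>ps. out = encode_pairs ps \<and> distinct ps \<and> set ps = active n a b \<and>
        sorted_wrt (flip_before f g) ps)"
  proof (rule triple_While[where \<mu> = ?c and I = ?I])
    fix k
    have "triple (\<lambda>m inp out. J a' ps m inp out \<and> F a' m \<and> m (cell 0 best_u) = u \<and>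
         m (cell 0 best_v) = v \<and> u \<noteq> v \<and> card (active n a' b) = k)
      (emit ;; select_best) ((3 + (S * 5 + 1)) + (3 + (S * 21 + 1)))
      (\<lambda>m inp out. ?I m inp out \<and> ?c m < k)" for a' ps u v
    proof (cases "\<exists>m inp out. J a' ps m inp out \<and> F a' m \<and> m (cell 0 best_u) = u \<and>
         m (cell 0 best_v) = v \<and> u \<noteq> v \<and> card (active n a' b) = k")
      case True
      define a2 where "a2 = (\<lambda>k. if a' k = u \<and> b k = v then v else a' k)"
      obtain m0 inp0 out0 where m0: "J a' ps m0 inp0 out0" "F a' m0" "m0 (cell 0 best_u) = u"
        "m0 (cell 0 best_v) = v" and uv: "u \<noteq> v" and k: "card (active n a' b) = k"
        using True by blast
      have A: "(u, v) \<in> active n a' b" "\<And>q. q \<in> active n a' b \<Longrightarrow> flip_before f g (u, v) q"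
        using m0 uv by (auto simp: F_def first_of_def)
      \<comment> \<open>Emitting a pair retires all edges that have it, so it cannot be selected
        again and the number of active pairs drops.\<close>
      have act: "active n a2 b = active n a' b - {(u, v)}"
        unfolding a2_def by (rule active_retire[OF uv])
      then have less: "card (active n a2 b) < k"
        using A(1) k finite_active[of n a' b] by (metis card_Diff1_less)
      have J: "J a2 (ps @ [(u, v)]) m inp (encode_pairs ps @ [u, v])"
        if "sort_state n f g a2 b m" for m inp
        using that m0(1) A unfolding J_def act
        by (auto simp: encode_pairs_snoc sorted_wrt_append)
      have e: "triple (\<lambda>m inp out. J a' ps m inp out \<and> F a' m \<and> m (cell 0 best_u) = u \<and>
         m (cell 0 best_v) = v \<and> u \<noteq> v \<and> card (active n a' b) = k) emit (3 + (S * 5 + 1))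
         (J a2 (ps @ [(u, v)]))"
        by (rule triple_conseq[OF emit_correct[OF assms, of f g a' b "encode_pairs ps" u v]])
          (use J in \<open>simp_all add: J_def a2_def\<close>)
      have "triple (J a2 (ps @ [(u, v)])) select_best (3 + (S * 21 + 1))
          (\<lambda>m inp out. ?I m inp out \<and> ?c m < k)"
      proof (rule triple_conseq[OF select])
        fix m inp out
        assume *: "J a2 (ps @ [(u, v)]) m inp out \<and> F a2 m"
        then have "sort_state n f g a2 b m" by (simp add: J_def)
        then show "?I m inp out \<and> ?c m < k" using * card less by auto
      qed auto
      from triple_Seq[OF e this] show ?thesis .
    qed (auto simp: triple_def)
    note * = triple_ex[OF triple_ex[OF triple_ex[OF triple_ex[OF this]]]]
    show "triple (\<lambda>m inp out. ?I m inp out \<and> expr_val (neq (var best_u) (var best_v)) m \<noteq> 0 \<and> ?c m = k)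
      (emit ;; select_best) ((3 + (S * 5 + 1)) + (3 + (S * 21 + 1)))
      (\<lambda>m inp out. ?I m inp out \<and> ?c m < k)"
    proof (rule triple_conseq[OF *])
      fix m inp out
      assume **: "?I m inp out \<and> expr_val (neq (var best_u) (var best_v)) m \<noteq> 0 \<and> ?c m = k"
      then obtain a' ps where J: "J a' ps m inp out" "F a' m" by blast
      then have "sort_state n f g a' b m" by (simp add: J_def)
      from card[OF this] J ** show "\<exists>v u ps a'. J a' ps m inp out \<and> F a' m \<and>
          m (cell 0 best_u) = u \<and> m (cell 0 best_v) = v \<and> u \<noteq> v \<and> card (active n a' b) = k"
        by auto
    qed auto
  next
    fix m inp out
    assume "?I m inp out" "expr_val (neq (var best_u) (var best_v)) m = 0"
    then show "\<exists>ps. out = encode_pairs ps \<and> distinct ps \<and> set ps = active n a b \<and>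
        sorted_wrt (flip_before f g) ps"
      by (auto simp: J_def F_def first_of_def)
  next
    fix m :: memory and inp out
    assume "?I m inp out"
    moreover have "?c m \<le> S" using card_active assms by (rule order_trans)
    ultimately show "?I m inp out \<and> ?c m \<le> S" by blast
  qed
  from triple_Seq[OF 1 2] show ?thesis by (simp add: sort_pairs_def)
qed


section \<open>Correctness and running time\<close>

definition rank_steps :: "nat \<Rightarrow> nat" where
  "rank_steps S = 1 + ((S * S + 1) * (2 + (S * 8 + 1) + 1) + 1)"

text \<open>Bracketed like the nested sequential composition, so that the composed triples match it
  syntactically.\<close>

definition flip_program_steps :: "nat \<Rightarrow> nat" where
  "flip_program_steps S = (1 + (S * (2 + 1) + 1)) +
     ((2 + (S * (1 + (S * (4 + 1) + 1 + 3) + 1) + 1)) + (rank_steps S + (rank_steps S +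
     ((3 + (S * 21 + 1)) + (S * ((3 + (S * 5 + 1)) + (3 + (S * 21 + 1)) + 1) + 1)))))"

lemma flip_program_steps_poly: "\<exists>q :: nat poly. \<forall>S. flip_program_steps S = poly q S"
proof (intro exI allI)
  let ?X = "[:0, 1:] :: nat poly"
  let ?r = "1 + ((?X * ?X + 1) * (2 + (?X * 8 + 1) + 1) + 1)"
  show "flip_program_steps S = poly ((1 + (?X * (2 + 1) + 1)) +
     ((2 + (?X * (1 + (?X * (4 + 1) + 1 + 3) + 1) + 1)) + (?r + (?r +
     ((3 + (?X * 21 + 1)) + (?X * ((3 + (?X * 5 + 1)) + (3 + (?X * 21 + 1)) + 1) + 1)))))) S" for S
    by (simp add: flip_program_steps_def rank_steps_def)
qed

lemma flip_program_correct:
  assumes w_def: "w = length vs # vs @ length es # concat (map (encode_edge h1 h2) es)"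
    and E_def: "E = set ` set es"
    and ao1: "acyclic_orientation E h1" and ao2: "acyclic_orientation E h2"
    and S: "length w \<le> S"
  shows "triple (\<lambda>m inp out. m = (\<lambda>_. 0) \<and> inp = w \<and> out = []) flip_program
    (flip_program_steps S)
    (\<lambda>m inp out. \<exists>g f. (ranks E h1 f \<and> ranks E h2 g) \<and>
       (\<exists>ps. out = encode_pairs ps \<and> distinct ps \<and> set ps = head_pairs E h1 h2 \<and>
         sorted_wrt (flip_before f g) ps))"
proof -
  interpret tape es h1 h2 S .
  have es: "length es \<le> length (concat (map (encode_edge h1 h2) es))"
    "length (concat es) \<le> length (concat (map (encode_edge h1 h2) es))"
    by (induction es) (auto simp: encode_edge_def)
  have U: "\<Union>E = set (concat es)" by (auto simp: E_def)
  then have card: "card (\<Union>E) \<le> S"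
    using card_length[of "concat es"] es S by (auto simp: w_def)
  have len: "length vs \<le> S" "length es \<le> S" using S es by (auto simp: w_def)
  have fin: "finite (\<Union>E)" using U by simp
  obtain d1 where d1: "ranks E h1 d1" "\<And>v. d1 v \<le> S"
    using bounded_ranks_exist[OF ao1 fin] card order_trans by metis
  obtain d2 where d2: "ranks E h2 d2" "\<And>v. d2 v \<le> S"
    using bounded_ranks_exist[OF ao2 fin] card order_trans by metis
  interpret r1: rank_computation es h1 h2 h1 S head1_arr rank1_arr rank2_arr d1 "\<lambda>_. 0"
    using d1 len by unfold_locales (auto simp: E_def)
  \<comment> \<open>\<open>z\<close> stays open: it becomes the result \<open>f\<close> of the first
    computation, which has to survive the second.\<close>
  have r2: "rank_computation es h1 h2 h2 S head2_arr rank2_arr rank1_arr d2"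
    using d2 len by unfold_locales (auto simp: E_def)
  have w: "w = length vs # vs @ (length es # rest 0)" by (simp add: w_def rest_def)
  have 1: "triple (\<lambda>m inp out. m = (\<lambda>_. 0) \<and> inp = w \<and> out = []) skip_vertices
      (1 + (S * (2 + 1) + 1)) (\<lambda>m inp out. blank m \<and> inp = length es # rest 0 \<and> length inp \<le> S \<and> out = [])"
    by (rule triple_conseq[OF skip_vertices_correct[OF len(1), of "length es # rest 0"]])
      (use w S in auto)
  note 2 = read_edges_correct[OF len(2)]
  have 3: "triple (\<lambda>m inp out. loaded es h1 h2 S m \<and> (\<forall>x. m (cell rank1_arr x) = 0) \<and>
       (\<forall>x. m (cell rank2_arr x) = 0) \<and> out = []) (compute_ranks head1_arr rank1_arr) (rank_steps S)
     (\<lambda>m inp out. \<exists>f. ranks E h1 f \<and> (loaded es h1 h2 S m \<and> (\<forall>x. m (cell rank2_arr x) = 0) \<and>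
       (\<forall>x. m (cell rank1_arr x) = f x) \<and> out = []))"
    unfolding rank_steps_def
    by (rule triple_conseq[OF r1.compute_ranks_correct]) (auto simp: E_def)
  have "triple (\<lambda>m inp out. ranks E h1 f \<and> (loaded es h1 h2 S m \<and> (\<forall>x. m (cell rank2_arr x) = 0) \<and>
       (\<forall>x. m (cell rank1_arr x) = f x) \<and> out = [])) (compute_ranks head2_arr rank2_arr) (rank_steps S)
     (\<lambda>m inp out. \<exists>g f. (ranks E h1 f \<and> ranks E h2 g) \<and> sort_state (length es) f g
        (\<lambda>k. h1 (set (es ! k))) (\<lambda>k. h2 (set (es ! k))) m \<and> out = [])" for f
    unfolding rank_steps_def
  proof (rule triple_conseq[OF triple_conj[OF rank_computation.compute_ranks_correct[OF r2]]])
    fix m inp out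
    assume "ranks E h1 f \<and> loaded es h1 h2 S m \<and> ranks (set ` set es) h2 (\<lambda>v. m (cell rank2_arr v)) \<and>
      (\<forall>x. m (cell rank1_arr x) = f x) \<and> out = []"
    then show "\<exists>g f. (ranks E h1 f \<and> ranks E h2 g) \<and> sort_state (length es) f g
        (\<lambda>k. h1 (set (es ! k))) (\<lambda>k. h2 (set (es ! k))) m \<and> out = []"
      by (intro exI[of _ "\<lambda>v. m (cell rank2_arr v)"] exI[of _ f])
        (simp add: sort_state_def loaded_def E_def)
  qed auto
  note 4 = triple_ex[OF this]
  have "E = {set (es ! k) |k. k < length es}"
    unfolding E_def by (auto simp: set_conv_nth)
  then have act: "active (length es) (\<lambda>k. h1 (set (es ! k))) (\<lambda>k. h2 (set (es ! k))) = head_pairs E h1 h2"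
    unfolding active_def head_pairs_def by blast
  have "triple (\<lambda>m inp out. (ranks E h1 f \<and> ranks E h2 g) \<and> (sort_state (length es) f g
        (\<lambda>k. h1 (set (es ! k))) (\<lambda>k. h2 (set (es ! k))) m \<and> out = [])) sort_pairs
     ((3 + (S * 21 + 1)) + (S * ((3 + (S * 5 + 1)) + (3 + (S * 21 + 1)) + 1) + 1))
     (\<lambda>m inp out. \<exists>g f. (ranks E h1 f \<and> ranks E h2 g) \<and>
       (\<exists>ps. out = encode_pairs ps \<and> distinct ps \<and> set ps = head_pairs E h1 h2 \<and>
         sorted_wrt (flip_before f g) ps))" for f g
    by (rule triple_conseq[OF triple_conj[OF sort_pairs_correct[OF len(2), of f g
          "\<lambda>k. h1 (set (es ! k))" "\<lambda>k. h2 (set (es ! k))", unfolded act]]]) blast+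
  note 5 = triple_ex[OF triple_ex[OF this]]
  from triple_Seq[OF 1 triple_Seq[OF 2 triple_Seq[OF 3 triple_Seq[OF 4 5]]]]
  show ?thesis unfolding flip_program_def flip_program_steps_def .
qed

theorem theorem5:
  "\<exists>(A :: prog) (p :: nat poly).
     \<forall>(V :: nat set) (E :: nat set set) h1 h2 w.
       hypergraph V E \<longrightarrow> acyclic_orientation E h1 \<longrightarrow> acyclic_orientation E h2 \<longrightarrow>
       encodes_instance w V E h1 h2 \<longrightarrow>
       (\<exists>t ps.
          runs A w t (encode_pairs ps) \<and>
          t \<le> poly p (tape_size w) \<and>
          flip_sequence V E h1 (map (\<lambda>(u, v). {u, v}) ps) h2 \<and>
          length ps \<le> max_codegree V E * flip_dist V E h1 h2)"
proof -
  obtain q :: "nat poly" where q: "\<And>S. flip_program_steps S = poly q S"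
    using flip_program_steps_poly by blast
  obtain p :: "nat poly" where p: "\<And>w n m inp out. unit_exec flip_program (\<lambda>_. 0, w, []) n (m, inp, out) \<Longrightarrow>
      n \<le> poly q (tape_size w) \<Longrightarrow> \<exists>t. runs flip_program w t out \<and> t \<le> poly p (tape_size w)"
    using poly_time_if_poly_steps[of flip_program q] by metis
  show ?thesis
  proof (intro exI[of _ flip_program] exI[of _ p] allI impI)
    fix V :: "nat set" and E h1 h2 w
    assume hyp: "hypergraph V E" and ao: "acyclic_orientation E h1" "acyclic_orientation E h2"
      and enc: "encodes_instance w V E h1 h2"
    from enc obtain vs es where "set (map set es) = E"
      and w: "w = length vs # vs @ length es # concat (map (encode_edge h1 h2) es)"
      unfolding encodes_instance_def by blast
    then have E: "E = set ` set es" by simp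
    have "\<exists>n m inp out. unit_exec flip_program (\<lambda>_. 0, w, []) n (m, inp, out) \<and>
       n \<le> flip_program_steps (tape_size w) \<and> (\<exists>g f. (ranks E h1 f \<and> ranks E h2 g) \<and>
       (\<exists>ps. out = encode_pairs ps \<and> distinct ps \<and> set ps = head_pairs E h1 h2 \<and>
         sorted_wrt (flip_before f g) ps))"
      using flip_program_correct[OF w E ao length_le_tape_size]
      unfolding triple_def by (elim allE, elim impE) (rule conjI refl)+
    then obtain n m inp out f g ps where run: "unit_exec flip_program (\<lambda>_. 0, w, []) n (m, inp, out)"
      "n \<le> poly q (tape_size w)"
      and post: "ranks E h1 f" "ranks E h2 g" "distinct ps"
      "set ps = head_pairs E h1 h2" "sorted_wrt (flip_before f g) ps" and out: "out = encode_pairs ps"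
      unfolding q by (elim exE conjE)
    from post interpret sorted_flips V E h1 h2 f g ps
      using hyp ao by unfold_locales
    obtain t where "runs flip_program w t out" "t \<le> poly p (tape_size w)"
      using p[OF run] by blast
    then show "\<exists>t ps. runs flip_program w t (encode_pairs ps) \<and> t \<le> poly p (tape_size w) \<and>
          flip_sequence V E h1 (map (\<lambda>(u, v). {u, v}) ps) h2 \<and>
          length ps \<le> max_codegree V E * flip_dist V E h1 h2"
      using flip_sequence_sorted length_sorted_le unfolding out by (intro exI conjI)
  qed
qed

end
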